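(* Let $\delta$ be a matrix of free polynomials in $d$ variables with $\delta(0)=0$, and let $f\in\mathcal{RSA}(B_\delta)$. Then for every $x\in B_\delta$, $$\|f(x)\|\le\|\delta(x)\|.$$ Moreover, if $B_\delta$ contains the noncommutative polydisc $\mathbb{D}_{nc}^d:=\{x=(x^1,\dots,x^d)\in\mathbb{M}^d : \max_{1\le r\le d}\|x^r\|<1\}$, then for every $n\ge1$ the Fr\'echet derivative of $f$ at $0\in(B_\delta)_n$, which is a linear map $\mathbb{M}_n^d\to\mathbb{M}_n$, is contractive.
   Context: Let $\mathbb{M}_n$ be the $n\times n$ complex matrices (with operator norm), $\mathbb{M}_n^d$ the $d$-tuples of $n\times n$ complex matrices with norm $\|x\|_n=\max_{1\le r\le d}\|x^r\|$, $\mathbb{M}^d=\coprod_{n\ge1}\mathbb{M}_n^d$ and $\mathbb{M}=\mathbb{M}^1$. A free polynomial in $d$ variables is an element of $\mathbb{C}\langle x_1,\dots,x_d\rangle$; it is evaluated on $x\in\mathbb{M}_n^d$ in the usual way to give an element of $\mathbb{M}_n$. If $\delta$ is an $s\times r$ matrix of free polynomials and $x\in\mathbb{M}_n^d$, then $\delta(x)$ is the $s\times r$ block matrix with $n\times n$ blocks obtained by entrywise evaluation, and $\|\delta(x)\|$ is its operator norm. Define $B_\delta=\{x\in\mathbb{M}^d: \|\delta(x)\|<1\}$ and $(B_\delta)_n=B_\delta\cap\mathbb{M}_n^d$, which is open in $\mathbb{M}_n^d$. Here $0$ denotes the zero tuple in any $\mathbb{M}_n^d$. For $\Omega\subset\mathbb{M}^d$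 closed under direct sums, with $\Omega_n=\Omega\cap\mathbb{M}_n^d$, a function $f:\Omega\to\mathbb{M}$ is an nc function if it is graded ($f(x)\in\mathbb{M}_n$ whenever $x\in\Omega_n$) and, whenever $x\in\Omega_n$, $y\in\Omega_m$ and an $m\times n$ matrix $\alpha$ satisfy $\alpha x=y\alpha$ (componentwise), then $\alpha f(x)=f(y)\alpha$. The regular nc Schur-Agler class $\mathcal{RSA}(B_\delta)$ is the set of nc functions $f:B_\delta\to\mathbb{M}$ with $\sup_{x\in B_\delta}\|f(x)\|\le1$ and $f(0)=0$. It is a known fact that locally bounded nc functions are holomorphic (Fr\'echet differentiable) on each level $(B_\delta)_n$. *)

theory Defs
  imports "Jordan_Normal_Form.Matrix" "HOL-Library.Poly_Mapping" "HOL-Analysis.L2_Norm"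
begin

text \<open>
  The variables are indexed by a finite (nonempty) type \<open>'d\<close>, so that \<open>d = CARD('d) \<ge> 1\<close>.
  A \<open>d\<close>-tuple of matrices is a function \<open>'d \<Rightarrow> complex mat\<close>.
\<close>

type_synonym 'd mat_tuple = "'d \<Rightarrow> complex mat"

definition tuples :: "nat \<Rightarrow> 'd mat_tuple set" where
  "tuples n = {x. \<forall>r. x r \<in> carrier_mat n n}"

definition zero_tuple :: "nat \<Rightarrow> 'd mat_tuple" where
  "zero_tuple n = (\<lambda>r. 0\<^sub>m n n)"

subsection \<open>Norms\<close>

definition op_norm :: "complex mat \<Rightarrow> real" where
  "op_norm A = (SUP v \<in> {v \<in> carrier_vec (dim_col A). L2_set (\<lambda>i. cmod (v $ i)) {..<dim_col A} \<le> 1}.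
     L2_set (\<lambda>i. cmod ((A *\<^sub>v v) $ i)) {..<dim_row A})"

definition tuple_norm :: "'d::finite mat_tuple \<Rightarrow> real" where
  "tuple_norm x = Max (range (\<lambda>r. op_norm (x r)))"

subsection \<open>Free polynomials and their evaluation\<close>

text \<open>
  The free algebra as the space of finitely supported coefficient functions on words in the
  variables; its product plays no role below.
\<close>

type_synonym 'd free_poly = "'d list \<Rightarrow>\<^sub>0 complex"

definition eval_word :: "nat \<Rightarrow> 'd list \<Rightarrow> 'd mat_tuple \<Rightarrow> complex mat" where
  "eval_word n w x = foldr (\<lambda>r A. x r * A) w (1\<^sub>m n)"

text \<open>The sum is taken entrywise because type \<open>mat\<close> has no zero common to all sizes.\<close>

definition eval_poly :: "nat \<Rightarrow> 'd free_poly \<Rightarrow> 'd mat_tuple \<Rightarrow> complex mat" where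
  "eval_poly n p x = mat n n (\<lambda>ij. \<Sum>w\<in>Poly_Mapping.keys p.
     Poly_Mapping.lookup p w * (eval_word n w x $$ ij))"

text \<open>The block at position \<open>(k, l)\<close> is \<open>\<delta>\<^sub>k\<^sub>l(x)\<close>.\<close>

definition eval_poly_mat :: "nat \<Rightarrow> 'd free_poly mat \<Rightarrow> 'd mat_tuple \<Rightarrow> complex mat" where
  "eval_poly_mat n \<delta> x = mat (dim_row \<delta> * n) (dim_col \<delta> * n)
     (\<lambda>(i, j). eval_poly n (\<delta> $$ (i div n, j div n)) x $$ (i mod n, j mod n))"

subsection \<open>Domains\<close>

definition B_level :: "'d free_poly mat \<Rightarrow> nat \<Rightarrow> 'd mat_tuple set" where
  "B_level \<delta> n = {x \<in> tuples n. op_norm (eval_poly_mat n \<delta> x) < 1}"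

definition B_set :: "'d free_poly mat \<Rightarrow> 'd mat_tuple set" where
  "B_set \<delta> = (\<Union>n\<in>{1..}. B_level \<delta> n)"

definition nc_polydisc :: "'d::finite mat_tuple set" where
  "nc_polydisc = (\<Union>n\<in>{1..}. {x \<in> tuples n. tuple_norm x < 1})"

subsection \<open>Noncommutative functions\<close>

text \<open>
  Closure of \<open>\<Omega>\<close> under direct sums is not part of the predicate; it holds for every \<open>B_set \<delta>\<close>,
  the only domains used here.
\<close>

definition nc_function :: "'d mat_tuple set \<Rightarrow> ('d mat_tuple \<Rightarrow> complex mat) \<Rightarrow> bool" where
  "nc_function \<Omega> f \<longleftrightarrow>
     (\<forall>n\<ge>1. \<forall>x \<in> \<Omega> \<inter> tuples n. f x \<in> carrier_mat n n) \<and>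
     (\<forall>n\<ge>1. \<forall>m\<ge>1. \<forall>x \<in> \<Omega> \<inter> tuples n. \<forall>y \<in> \<Omega> \<inter> tuples m. \<forall>\<alpha> \<in> carrier_mat m n.
        (\<forall>r. \<alpha> * x r = y r * \<alpha>) \<longrightarrow> \<alpha> * f x = f y * \<alpha>)"

text \<open>Here \<open>0\<close> is the zero tuple of every level. The class is used only when \<open>\<delta>(0) = 0\<close>, so
  that these tuples lie in the domain.\<close>

definition RSA :: "'d free_poly mat \<Rightarrow> ('d mat_tuple \<Rightarrow> complex mat) set" where
  "RSA \<delta> = {f. nc_function (B_set \<delta>) f \<and> (\<forall>x \<in> B_set \<delta>. op_norm (f x) \<le> 1) \<and>
     (\<forall>n\<ge>1. f (zero_tuple n) = 0\<^sub>m n n)}"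

subsection \<open>Frechet derivatives on a level\<close>

text \<open>
  Type \<open>mat\<close> contains matrices of all sizes and carries no normed space structure, so linearity
  and differentiability on the level \<open>n\<close> are spelled out relative to \<open>tuples n\<close>.
  A derivative \<open>L\<close> is determined only on \<open>tuples n\<close>.
\<close>

definition linear_on_level :: "nat \<Rightarrow> ('d mat_tuple \<Rightarrow> complex mat) \<Rightarrow> bool" where
  "linear_on_level n L \<longleftrightarrow>
     (\<forall>h \<in> tuples n. L h \<in> carrier_mat n n) \<and>
     (\<forall>h \<in> tuples n. \<forall>k \<in> tuples n. L (\<lambda>r. h r + k r) = L h + L k) \<and>
     (\<forall>c. \<forall>h \<in> tuples n. L (\<lambda>r. c \<cdot>\<^sub>m h r) = c \<cdot>\<^sub>m L h)"

definition has_frechet_derivative_at ::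
  "nat \<Rightarrow> 'd::finite mat_tuple set \<Rightarrow> ('d mat_tuple \<Rightarrow> complex mat) \<Rightarrow> 'd mat_tuple \<Rightarrow>
    ('d mat_tuple \<Rightarrow> complex mat) \<Rightarrow> bool" where
  "has_frechet_derivative_at n \<Omega> f x L \<longleftrightarrow> linear_on_level n L \<and>
     (\<forall>\<epsilon>>0. \<exists>\<eta>>0. \<forall>h \<in> tuples n. tuple_norm h < \<eta> \<longrightarrow>
        (\<lambda>r. x r + h r) \<in> \<Omega> \<and>
        op_norm (f (\<lambda>r. x r + h r) - f x - L h) \<le> \<epsilon> * tuple_norm h)"

definition contractive_on_level :: "nat \<Rightarrow> ('d::finite mat_tuple \<Rightarrow> complex mat) \<Rightarrow> bool" where
  "contractive_on_level n L \<longleftrightarrow> (\<forall>h \<in> tuples n. op_norm (L h) \<le> tuple_norm h)"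

end

theory Submission imports Defs
begin

text \<open>
  For \<open>x \<in> B\<^sub>\<delta>\<close> and real \<open>t\<close> put \<open>y = x \<otimes> C\<close> with the idempotent \<open>C\<close> that has rows \<open>(0, t)\<close> and
  \<open>(0, 1)\<close>. As \<open>\<delta>\<close> and \<open>f\<close> vanish at 0, both are compatible with this dilation:
  \<open>\<delta>(y) = \<delta>(x) \<otimes> C\<close> and \<open>f(y) = f(x) \<otimes> C\<close>. Since \<open>C\<close> has norm \<open>g = sqrt (1 + t\<^sup>2)\<close>, the
  bound \<open>g \<parallel>\<delta>(x)\<parallel> < 1\<close> puts \<open>y\<close> into \<open>B\<^sub>\<delta>\<close> and therefore implies \<open>g \<parallel>f(x)\<parallel> \<le> 1\<close>. Varying \<open>t\<close>
  gives \<open>\<parallel>f(x)\<parallel> \<le> \<parallel>\<delta>(x)\<parallel>\<close>, and the same argument on the polydisc gives \<open>\<parallel>f(x)\<parallel> \<le> \<parallel>x\<parallel>\<close>.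

  The derivative at 0 is the upper right block of \<open>f(h \<otimes> E\<^sub>1\<^sub>2)\<close>, extended by homogeneity. Additivity
  comes from intertwining with \<open>h \<otimes> E\<^sub>1\<^sub>3 + k \<otimes> E\<^sub>2\<^sub>3\<close>. For the matrix \<open>C\<close> with rows
  \<open>(0, a, 0)\<close>, \<open>(0, 0, a)\<close>, \<open>(0, 0, 1)\<close>, the upper right block of \<open>f(h \<otimes> C)\<close> is
  \<open>a\<^sup>2\<close> times the remainder \<open>f(h) - f'(0) h\<close>, which makes the remainder at most \<open>1 / a\<^sup>2\<close>, with \<open>a\<close>
  of the order of \<open>1 / \<parallel>h\<parallel>\<close>. Contractivity follows from \<open>\<parallel>f(h)\<parallel> \<le> \<parallel>h\<parallel>\<close>.
\<close>

section \<open>Index arithmetic for block matrices\<close>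

lemma sum_lessThan_mult:
  fixes g :: "nat \<Rightarrow> 'a::comm_monoid_add"
  shows "(\<Sum>p<n * k. g p) = (\<Sum>i<n. \<Sum>c<k. g (i * k + c))"
proof -
  have "(\<Sum>c<k. g (i * k + c)) = sum g {i * k..<i * k + k}" for i
    using sum.shift_bounds_nat_ivl[of g 0 "i * k" k]
    by (simp add: add.commute atLeast0LessThan)
  then show ?thesis
    using sum.nat_group[of g k n] by simp
qed

lemma block_index_less: "i < n \<Longrightarrow> c < k \<Longrightarrow> i * k + c < n * (k::nat)"
proof -
  assume "i < n" "c < k"
  then have "i * k + c < Suc i * k" by simp
  also have "\<dots> \<le> n * k" using \<open>i < n\<close> by (intro mult_right_mono) auto
  finally show ?thesis .
qed

section \<open>The operator norm\<close>

text \<open>\<open>op_norm\<close> is a supremum of reals, so nothing bounds it from below until the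
  set is known to be bounded. The coordinates of a vector in the unit ball have modulus at most 1,
  so the sum of the moduli of all entries of \<open>A\<close> is a crude bound.\<close>

lemma bdd_above_op_norm:
  "bdd_above ((\<lambda>v. L2_set (\<lambda>i. cmod ((A *\<^sub>v v) $ i)) {..<dim_row A}) `
     {v \<in> carrier_vec (dim_col A). L2_set (\<lambda>i. cmod (v $ i)) {..<dim_col A} \<le> 1})"
proof (rule bdd_aboveI2)
  fix v assume v: "v \<in> {v \<in> carrier_vec (dim_col A). L2_set (\<lambda>i. cmod (v $ i)) {..<dim_col A} \<le> 1}"
  have 1: "cmod (v $ j) \<le> 1" if "j < dim_col A" for j
    using member_le_L2_set[of "{..<dim_col A}" j "\<lambda>i. cmod (v $ i)"] v that by simp
  have "L2_set (\<lambda>i. cmod ((A *\<^sub>v v) $ i)) {..<dim_row A} \<le> (\<Sum>i<dim_row A. cmod ((A *\<^sub>v v) $ i))"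
    by (rule L2_set_le_sum) simp
  also have "\<dots> \<le> (\<Sum>i<dim_row A. \<Sum>j<dim_col A. cmod (A $$ (i, j)))"
  proof (rule sum_mono)
    fix i assume "i \<in> {..<dim_row A}"
    then have "(A *\<^sub>v v) $ i = (\<Sum>j<dim_col A. A $$ (i, j) * v $ j)"
      using v by (auto simp: scalar_prod_def atLeast0LessThan)
    also have "cmod \<dots> \<le> (\<Sum>j<dim_col A. cmod (A $$ (i, j)))"
      by (rule sum_norm_le) (use 1 in \<open>auto simp: norm_mult intro!: mult_left_le\<close>)
    finally show "cmod ((A *\<^sub>v v) $ i) \<le> (\<Sum>j<dim_col A. cmod (A $$ (i, j)))" .
  qed
  finally show "L2_set (\<lambda>i. cmod ((A *\<^sub>v v) $ i)) {..<dim_row A} \<le>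
    (\<Sum>i<dim_row A. \<Sum>j<dim_col A. cmod (A $$ (i, j)))" .
qed

lemma op_norm_nonneg: "0 \<le> op_norm A"
proof -
  have "0 \<le> L2_set (\<lambda>i. cmod ((A *\<^sub>v 0\<^sub>v (dim_col A)) $ i)) {..<dim_row A}"
    by simp
  also have "\<dots> \<le> op_norm A"
    unfolding op_norm_def
    by (rule cSUP_upper[OF _ bdd_above_op_norm]) (simp add: L2_set_def)
  finally show ?thesis .
qed

lemma mult_mat_vec_L2_le:
  assumes v: "v \<in> carrier_vec (dim_col A)"
  shows "L2_set (\<lambda>i. cmod ((A *\<^sub>v v) $ i)) {..<dim_row A} \<le>
    op_norm A * L2_set (\<lambda>j. cmod (v $ j)) {..<dim_col A}"
proof (cases "L2_set (\<lambda>j. cmod (v $ j)) {..<dim_col A} = 0")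
  case True
  then have "v = 0\<^sub>v (dim_col A)"
    using v by (auto simp: L2_set_eq_0_iff intro!: eq_vecI)
  then have "L2_set (\<lambda>i. cmod ((A *\<^sub>v v) $ i)) {..<dim_row A} = 0"
    by (simp add: L2_set_eq_0_iff)
  then show ?thesis using op_norm_nonneg[of A] by simp
next
  case False
  define c where "c = L2_set (\<lambda>j. cmod (v $ j)) {..<dim_col A}"
  have c: "c > 0" using False by (simp add: c_def less_le)
  define u where "u = complex_of_real (1 / c) \<cdot>\<^sub>v v"
  have u: "u \<in> carrier_vec (dim_col A)" using v by (simp add: u_def)
  have "L2_set (\<lambda>j. cmod (u $ j)) {..<dim_col A} = L2_set (\<lambda>j. (1 / c) * cmod (v $ j)) {..<dim_col A}"
    using v c by (intro L2_set_cong) (auto simp: u_def norm_mult norm_divide)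
  also have "\<dots> = 1"
    using c by (subst L2_set_right_distrib[symmetric]) (auto simp: c_def[symmetric])
  finally have "L2_set (\<lambda>i. cmod ((A *\<^sub>v u) $ i)) {..<dim_row A} \<le> op_norm A"
    unfolding op_norm_def
    using u by (intro cSUP_upper[OF _ bdd_above_op_norm]) simp
  also have "L2_set (\<lambda>i. cmod ((A *\<^sub>v u) $ i)) {..<dim_row A} =
      L2_set (\<lambda>i. (1 / c) * cmod ((A *\<^sub>v v) $ i)) {..<dim_row A}"
    using v c by (intro L2_set_cong) (auto simp: u_def norm_mult norm_divide)
  also have "\<dots> = (1 / c) * L2_set (\<lambda>i. cmod ((A *\<^sub>v v) $ i)) {..<dim_row A}"
    using c by (subst L2_set_right_distrib) auto
  finally show ?thesis using c by (simp add: field_simps c_def)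
qed

text \<open>Together with \<open>op_norm_leI\<close> this turns norm estimates into inequalities
  between sums of squares, without square roots. Vectors become plain functions, so that slices of a
  vector need no carrier.\<close>

lemma op_norm_bound:
  assumes "A \<in> carrier_mat m n"
  shows "(\<Sum>i<m. (cmod (\<Sum>j<n. A $$ (i, j) * v j))\<^sup>2) \<le> (op_norm A)\<^sup>2 * (\<Sum>j<n. (cmod (v j))\<^sup>2)"
proof -
  have "L2_set (\<lambda>i. cmod ((A *\<^sub>v vec n v) $ i)) {..<m} \<le>
      op_norm A * L2_set (\<lambda>j. cmod (vec n v $ j)) {..<n}"
    using mult_mat_vec_L2_le[of "vec n v" A] assms by auto
  then have "(L2_set (\<lambda>i. cmod ((A *\<^sub>v vec n v) $ i)) {..<m})\<^sup>2 \<le>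
      (op_norm A * L2_set (\<lambda>j. cmod (vec n v $ j)) {..<n})\<^sup>2"
    by (intro power_mono) auto
  then show ?thesis
    using assms
    by (simp add: L2_set_def sum_nonneg power_mult_distrib scalar_prod_def atLeast0LessThan
        del: power_mono_iff)
qed

lemma op_norm_leI:
  assumes "A \<in> carrier_mat m n" "0 \<le> c"
    and "\<And>v. (\<Sum>i<m. (cmod (\<Sum>j<n. A $$ (i, j) * v j))\<^sup>2) \<le> c\<^sup>2 * (\<Sum>j<n. (cmod (v j))\<^sup>2)"
  shows "op_norm A \<le> c"
  unfolding op_norm_def
proof (rule cSUP_least)
  show "{v \<in> carrier_vec (dim_col A). L2_set (\<lambda>i. cmod (v $ i)) {..<dim_col A} \<le> 1} \<noteq> {}"
    by (auto intro!: exI[of _ "0\<^sub>v (dim_col A)"] simp: L2_set_def)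
  fix v assume v: "v \<in> {v \<in> carrier_vec (dim_col A). L2_set (\<lambda>i. cmod (v $ i)) {..<dim_col A} \<le> 1}"
  have "(\<Sum>i<m. (cmod ((A *\<^sub>v v) $ i))\<^sup>2) = (\<Sum>i<m. (cmod (\<Sum>j<n. A $$ (i, j) * v $ j))\<^sup>2)"
    using v assms(1) by (auto simp: scalar_prod_def atLeast0LessThan)
  also have "\<dots> \<le> c\<^sup>2 * (\<Sum>j<n. (cmod (v $ j))\<^sup>2)" by (rule assms(3))
  also have "\<dots> \<le> c\<^sup>2 * 1"
    using v assms(1) by (intro mult_left_mono) (auto simp: L2_set_def)
  finally have "sqrt (\<Sum>i<m. (cmod ((A *\<^sub>v v) $ i))\<^sup>2) \<le> sqrt (c\<^sup>2)"
    by (intro real_sqrt_le_mono) simp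
  then show "L2_set (\<lambda>i. cmod ((A *\<^sub>v v) $ i)) {..<dim_row A} \<le> c"
    using assms(1,2) by (auto simp: L2_set_def)
qed

lemma op_norm_smult_le:
  assumes A: "A \<in> carrier_mat m n"
  shows "op_norm (c \<cdot>\<^sub>m A) \<le> cmod c * op_norm A"
proof (rule op_norm_leI)
  show "c \<cdot>\<^sub>m A \<in> carrier_mat m n" using A by simp
  show "0 \<le> cmod c * op_norm A" by (simp add: op_norm_nonneg)
  fix v :: "nat \<Rightarrow> complex"
  have "(\<Sum>i<m. (cmod (\<Sum>j<n. (c \<cdot>\<^sub>m A) $$ (i, j) * v j))\<^sup>2) =
      (\<Sum>i<m. (cmod c)\<^sup>2 * (cmod (\<Sum>j<n. A $$ (i, j) * v j))\<^sup>2)"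
    using A by (intro sum.cong) (auto simp: mult.assoc norm_mult power_mult_distrib
        simp flip: sum_distrib_left)
  also have "\<dots> = (cmod c)\<^sup>2 * (\<Sum>i<m. (cmod (\<Sum>j<n. A $$ (i, j) * v j))\<^sup>2)"
    by (simp add: sum_distrib_left)
  also have "\<dots> \<le> (cmod c)\<^sup>2 * ((op_norm A)\<^sup>2 * (\<Sum>j<n. (cmod (v j))\<^sup>2))"
    by (intro mult_left_mono op_norm_bound A) auto
  finally show "(\<Sum>i<m. (cmod (\<Sum>j<n. (c \<cdot>\<^sub>m A) $$ (i, j) * v j))\<^sup>2) \<le>
      (cmod c * op_norm A)\<^sup>2 * (\<Sum>j<n. (cmod (v j))\<^sup>2)"
    by (simp add: power_mult_distrib mult.assoc)
qed

text \<open>For nonzero \<open>c\<close> the reverse inequality is \<open>op_norm_smult_le\<close>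
  for the inverse scalar.\<close>

lemma op_norm_smult:
  assumes A: "A \<in> carrier_mat m n"
  shows "op_norm (c \<cdot>\<^sub>m A) = cmod c * op_norm A"
proof (cases "c = 0")
  case True
  then show ?thesis
    using op_norm_smult_le[OF A, of c] op_norm_nonneg[of "c \<cdot>\<^sub>m A"] by simp
next
  case False
  have "inverse c \<cdot>\<^sub>m (c \<cdot>\<^sub>m A) = A" using A False by (intro eq_matI) auto
  then have "op_norm A \<le> cmod (inverse c) * op_norm (c \<cdot>\<^sub>m A)"
    using op_norm_smult_le[of "c \<cdot>\<^sub>m A" m n "inverse c"] A by simp
  then show ?thesis
    using op_norm_smult_le[OF A, of c] False by (simp add: norm_inverse norm_divide field_simps)
qed

lemma op_norm_triangle:
  assumes A: "A \<in> carrier_mat m n" and B: "B \<in> carrier_mat m n"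
  shows "op_norm (A + B) \<le> op_norm A + op_norm B"
  unfolding op_norm_def[of "A + B"]
proof (rule cSUP_least)
  show "{v \<in> carrier_vec (dim_col (A + B)). L2_set (\<lambda>i. cmod (v $ i)) {..<dim_col (A + B)} \<le> 1} \<noteq> {}"
    by (auto intro!: exI[of _ "0\<^sub>v (dim_col B)"] simp: L2_set_def)
  fix v assume "v \<in> {v \<in> carrier_vec (dim_col (A + B)). L2_set (\<lambda>i. cmod (v $ i)) {..<dim_col (A + B)} \<le> 1}"
  then have v: "v \<in> carrier_vec n" and v1: "L2_set (\<lambda>i. cmod (v $ i)) {..<n} \<le> 1"
    using A B by auto
  have "L2_set (\<lambda>i. cmod (((A + B) *\<^sub>v v) $ i)) {..<m} \<le>
      L2_set (\<lambda>i. cmod ((A *\<^sub>v v) $ i) + cmod ((B *\<^sub>v v) $ i)) {..<m}"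
    using A B v add_mult_distrib_mat_vec[OF A B v]
    by (intro L2_set_mono) (auto simp: norm_triangle_ineq simp del: index_mult_mat_vec)
  also have "\<dots> \<le> L2_set (\<lambda>i. cmod ((A *\<^sub>v v) $ i)) {..<m} + L2_set (\<lambda>i. cmod ((B *\<^sub>v v) $ i)) {..<m}"
    by (rule L2_set_triangle_ineq)
  also have "\<dots> \<le> op_norm A * L2_set (\<lambda>i. cmod (v $ i)) {..<n} + op_norm B * L2_set (\<lambda>i. cmod (v $ i)) {..<n}"
    using mult_mat_vec_L2_le[of v A] mult_mat_vec_L2_le[of v B] A B v by (intro add_mono) auto
  also have "\<dots> \<le> op_norm A + op_norm B"
    using v1 op_norm_nonneg by (intro add_mono mult_left_le) auto
  finally show "L2_set (\<lambda>i. cmod (((A + B) *\<^sub>v v) $ i)) {..<dim_row (A + B)} \<le> op_norm A + op_norm B"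
    using A B by simp
qed

text \<open>Extending a vector by zero outside the range of \<open>q\<close> keeps its length, and
  discarding rows outside the range of \<open>p\<close> only shortens the image. Arbitrary injective
  index maps are allowed because the blocks cut out of values of \<open>f\<close> later are
  interleaved, not contiguous.\<close>

lemma op_norm_submatrix_le:
  assumes M: "M \<in> carrier_mat m n"
    and p: "inj_on p {..<m'}" "p ` {..<m'} \<subseteq> {..<m}"
    and q: "inj_on q {..<n'}" "q ` {..<n'} \<subseteq> {..<n}"
  shows "op_norm (mat m' n' (\<lambda>(i, j). M $$ (p i, q j))) \<le> op_norm M"
proof (rule op_norm_leI)
  fix v :: "nat \<Rightarrow> complex"
  define w where "w J = (if J \<in> q ` {..<n'} then v (the_inv_into {..<n'} q J) else 0)" for J
  have w: "w (q j) = v j" if "j < n'" for j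
    using that q by (simp add: w_def the_inv_into_f_f)
  \<comment> \<open>Stated for any summand vanishing at 0, since it serves both the complex
    matrix-vector sums and the real squared length of the vector.\<close>
  have E: "(\<Sum>J<n. g (w J) J) = (\<Sum>j<n'. g (v j) (q j))" if "\<And>J. g 0 J = 0"
    for g :: "complex \<Rightarrow> nat \<Rightarrow> 'x::comm_monoid_add"
  proof -
    have "(\<Sum>J<n. g (w J) J) = (\<Sum>J\<in>q ` {..<n'}. g (w J) J)"
      by (rule sum.mono_neutral_right) (use q that in \<open>auto simp: w_def\<close>)
    also have "\<dots> = (\<Sum>j<n'. g (v j) (q j))"
      using q w by (simp add: sum.reindex)
    finally show ?thesis .
  qed
  have "(\<Sum>i<m'. (cmod (\<Sum>j<n'. mat m' n' (\<lambda>(i, j). M $$ (p i, q j)) $$ (i, j) * v j))\<^sup>2) =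
      (\<Sum>i<m'. (cmod (\<Sum>J<n. M $$ (p i, J) * w J))\<^sup>2)"
    by (intro sum.cong refl) (auto simp: E[of "\<lambda>z J. M $$ (_, J) * z"])
  also have "\<dots> = (\<Sum>I\<in>p ` {..<m'}. (cmod (\<Sum>J<n. M $$ (I, J) * w J))\<^sup>2)"
    using p by (simp add: sum.reindex)
  also have "\<dots> \<le> (\<Sum>I<m. (cmod (\<Sum>J<n. M $$ (I, J) * w J))\<^sup>2)"
    by (rule sum_mono2) (use p in auto)
  also have "\<dots> \<le> (op_norm M)\<^sup>2 * (\<Sum>J<n. (cmod (w J))\<^sup>2)"
    by (rule op_norm_bound[OF M])
  also have "(\<Sum>J<n. (cmod (w J))\<^sup>2) = (\<Sum>j<n'. (cmod (v j))\<^sup>2)"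
    by (rule E[of "\<lambda>z J. (cmod z)\<^sup>2"]) simp
  finally show "(\<Sum>i<m'. (cmod (\<Sum>j<n'. mat m' n' (\<lambda>(i, j). M $$ (p i, q j)) $$ (i, j) * v j))\<^sup>2) \<le>
      (op_norm M)\<^sup>2 * (\<Sum>j<n'. (cmod (v j))\<^sup>2)" .
qed (simp_all add: op_norm_nonneg)

section \<open>Norms of tuples\<close>

lemma op_norm_le_tuple_norm: "op_norm (x r) \<le> tuple_norm x"
  unfolding tuple_norm_def by (intro Max_ge) auto

lemma tuple_norm_nonneg: "0 \<le> tuple_norm x"
  using op_norm_nonneg op_norm_le_tuple_norm order.trans by blast

lemma tuple_norm_leI: "(\<And>r. op_norm (x r) \<le> c) \<Longrightarrow> tuple_norm x \<le> c"
  unfolding tuple_norm_def by auto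

lemma tuple_norm_smult_le:
  assumes "x \<in> tuples n"
  shows "tuple_norm (\<lambda>r. c \<cdot>\<^sub>m x r) \<le> cmod c * tuple_norm x"
proof (rule tuple_norm_leI)
  fix r
  have "op_norm (c \<cdot>\<^sub>m x r) = cmod c * op_norm (x r)"
    using assms op_norm_smult[of "x r" n n] by (simp add: tuples_def)
  also have "\<dots> \<le> cmod c * tuple_norm x"
    by (intro mult_left_mono op_norm_le_tuple_norm) auto
  finally show "op_norm (c \<cdot>\<^sub>m x r) \<le> cmod c * tuple_norm x" .
qed

section \<open>Kronecker products\<close>

definition kron :: "complex mat \<Rightarrow> complex mat \<Rightarrow> complex mat" where
  "kron A B = mat (dim_row A * dim_row B) (dim_col A * dim_col B)
     (\<lambda>(i, j). A $$ (i div dim_row B, j div dim_col B) * B $$ (i mod dim_row B, j mod dim_col B))"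

lemma kron_carrier [intro, simp]:
  "A \<in> carrier_mat m n \<Longrightarrow> B \<in> carrier_mat k l \<Longrightarrow> kron A B \<in> carrier_mat (m * k) (n * l)"
  by (auto simp: kron_def)

lemma index_kron:
  assumes "A \<in> carrier_mat m n" "B \<in> carrier_mat k l" "i < m" "c < k" "j < n" "d < l"
  shows "kron A B $$ (i * k + c, j * l + d) = A $$ (i, j) * B $$ (c, d)"
  using assms block_index_less[of i m c k] block_index_less[of j n d l] by (auto simp: kron_def)

lemma eq_block_matI:
  assumes "M \<in> carrier_mat (m * k) (n * l)" "N \<in> carrier_mat (m * k) (n * l)"
    and "\<And>i c j d. i < m \<Longrightarrow> c < k \<Longrightarrow> j < n \<Longrightarrow> d < l \<Longrightarrow>
      M $$ (i * k + c, j * l + d) = N $$ (i * k + c, j * l + d)"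
  shows "M = N"
proof (rule eq_matI)
  fix I J assume IJ: "I < dim_row N" "J < dim_col N"
  then have 1: "I < m * k" "J < n * l" using assms by auto
  then have "k > 0" "l > 0" by (auto intro: Nat.gr0I)
  with 1 have "I div k < m" "J div l < n" "I mod k < k" "J mod l < l"
    by (auto simp: less_mult_imp_div_less)
  then show "M $$ (I, J) = N $$ (I, J)" using assms(3)[of "I div k" "I mod k" "J div l" "J mod l"] by simp
qed (use assms in auto)

lemma index_mult_mat_sum:
  assumes "A \<in> carrier_mat m k" "B \<in> carrier_mat k n" "i < m" "j < n"
  shows "(A * B) $$ (i, j) = (\<Sum>l<k. A $$ (i, l) * B $$ (l, j))"
  using assms by (auto simp: scalar_prod_def atLeast0LessThan)

text \<open>The mixed product rule. Evaluation of words at dilated tuples and the intertwining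
  relations below both reduce to it.\<close>

lemma kron_mult:
  assumes A: "A \<in> carrier_mat m n" and B: "B \<in> carrier_mat k l"
    and C: "C \<in> carrier_mat n p" and D: "D \<in> carrier_mat l q"
  shows "kron A B * kron C D = kron (A * C) (B * D)"
proof (rule eq_block_matI[of _ m k p q])
  show "kron A B * kron C D \<in> carrier_mat (m * k) (p * q)"
    by (rule mult_carrier_mat[OF kron_carrier[OF A B] kron_carrier[OF C D]])
  show "kron (A * C) (B * D) \<in> carrier_mat (m * k) (p * q)"
    using A B C D by simp
  fix i c j d assume i: "i < m" "c < k" "j < p" "d < q"
  have "(kron A B * kron C D) $$ (i * k + c, j * q + d) =
      (\<Sum>a<n. \<Sum>b<l. kron A B $$ (i * k + c, a * l + b) * kron C D $$ (a * l + b, j * q + d))"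
    using i by (subst index_mult_mat_sum[OF kron_carrier[OF A B] kron_carrier[OF C D]])
      (auto simp: block_index_less sum_lessThan_mult)
  also have "\<dots> = (\<Sum>a<n. \<Sum>b<l. (A $$ (i, a) * C $$ (a, j)) * (B $$ (c, b) * D $$ (b, d)))"
    using i by (intro sum.cong refl) (auto simp: index_kron[OF A B] index_kron[OF C D])
  also have "\<dots> = (A * C) $$ (i, j) * (B * D) $$ (c, d)"
    using i by (simp add: index_mult_mat_sum[OF A C] index_mult_mat_sum[OF B D] sum_product
        del: index_mult_mat)
  also have "\<dots> = kron (A * C) (B * D) $$ (i * k + c, j * q + d)"
    using i A B C D by (subst index_kron[of _ m p _ k q]) auto
  finally show "(kron A B * kron C D) $$ (i * k + c, j * q + d) =
    kron (A * C) (B * D) $$ (i * k + c, j * q + d)" .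
qed

text \<open>First \<open>B\<close> acts inside each block of \<open>v\<close>, giving
  \<open>w\<close>; then, for each fixed position \<open>c\<close>, \<open>A\<close> acts across the
  blocks. Swapping the two outer sums lets \<open>op_norm_bound\<close> be applied once for each
  factor.\<close>

lemma op_norm_kron_le:
  assumes A: "A \<in> carrier_mat m n" and B: "B \<in> carrier_mat k l"
  shows "op_norm (kron A B) \<le> op_norm A * op_norm B"
proof (rule op_norm_leI[OF kron_carrier[OF A B]])
  show "0 \<le> op_norm A * op_norm B" by (simp add: op_norm_nonneg)
  fix v :: "nat \<Rightarrow> complex"
  define w where "w c j = (\<Sum>d<l. B $$ (c, d) * v (j * l + d))" for c j
  have "(\<Sum>I<m * k. (cmod (\<Sum>J<n * l. kron A B $$ (I, J) * v J))\<^sup>2) =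
      (\<Sum>i<m. \<Sum>c<k. (cmod (\<Sum>j<n. \<Sum>d<l. A $$ (i, j) * B $$ (c, d) * v (j * l + d)))\<^sup>2)"
    by (simp add: sum_lessThan_mult index_kron[OF A B])
  also have "\<dots> = (\<Sum>i<m. \<Sum>c<k. (cmod (\<Sum>j<n. A $$ (i, j) * w c j))\<^sup>2)"
    by (simp add: w_def sum_distrib_left mult.assoc)
  also have "\<dots> = (\<Sum>c<k. \<Sum>i<m. (cmod (\<Sum>j<n. A $$ (i, j) * w c j))\<^sup>2)"
    by (rule sum.swap)
  also have "\<dots> \<le> (\<Sum>c<k. (op_norm A)\<^sup>2 * (\<Sum>j<n. (cmod (w c j))\<^sup>2))"
    by (intro sum_mono op_norm_bound A)
  also have "\<dots> = (op_norm A)\<^sup>2 * (\<Sum>c<k. \<Sum>j<n. (cmod (w c j))\<^sup>2)"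
    by (simp add: sum_distrib_left)
  also have "(\<Sum>c<k. \<Sum>j<n. (cmod (w c j))\<^sup>2) = (\<Sum>j<n. \<Sum>c<k. (cmod (w c j))\<^sup>2)"
    by (rule sum.swap)
  also have "(op_norm A)\<^sup>2 * \<dots> \<le> (op_norm A)\<^sup>2 * (\<Sum>j<n. (op_norm B)\<^sup>2 * (\<Sum>d<l. (cmod (v (j * l + d)))\<^sup>2))"
    unfolding w_def by (intro mult_left_mono sum_mono op_norm_bound B) auto
  also have "\<dots> = (op_norm A * op_norm B)\<^sup>2 * (\<Sum>J<n * l. (cmod (v J))\<^sup>2)"
    by (simp add: sum_lessThan_mult sum_distrib_left power_mult_distrib mult.assoc)
  finally show "(\<Sum>I<m * k. (cmod (\<Sum>J<n * l. kron A B $$ (I, J) * v J))\<^sup>2) \<le>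
    (op_norm A * op_norm B)\<^sup>2 * (\<Sum>J<n * l. (cmod (v J))\<^sup>2)" .
qed

text \<open>Every intertwiner used below has the form \<open>kron (1\<^sub>m n) P\<close>.
  Multiplying by it touches only the small index, so relations between values of \<open>f\<close>
  become relations between a few blocks.\<close>

lemma index_kron_one_mult:
  assumes P: "P \<in> carrier_mat k l" and M: "M \<in> carrier_mat (n * l) q"
    and "i < n" "c < k" "J < q"
  shows "(kron (1\<^sub>m n) P * M) $$ (i * k + c, J) = (\<Sum>d<l. P $$ (c, d) * M $$ (i * l + d, J))"
proof -
  have "(kron (1\<^sub>m n) P * M) $$ (i * k + c, J) =
      (\<Sum>a<n. \<Sum>d<l. (if i = a then P $$ (c, d) * M $$ (i * l + d, J) else 0))"
    using assms
    by (subst index_mult_mat_sum[OF kron_carrier[OF one_carrier_mat P] M])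
      (auto simp: block_index_less sum_lessThan_mult index_kron[OF one_carrier_mat P] intro!: sum.cong)
  also have "\<dots> = (\<Sum>a<n. if i = a then (\<Sum>d<l. P $$ (c, d) * M $$ (i * l + d, J)) else 0)"
    by (intro sum.cong) auto
  finally show ?thesis using assms by simp
qed

lemma index_mult_kron_one:
  assumes P: "P \<in> carrier_mat k l" and M: "M \<in> carrier_mat q (n * k)"
    and "j < n" "d < l" "I < q"
  shows "(M * kron (1\<^sub>m n) P) $$ (I, j * l + d) = (\<Sum>c<k. M $$ (I, j * k + c) * P $$ (c, d))"
proof -
  have "(M * kron (1\<^sub>m n) P) $$ (I, j * l + d) =
      (\<Sum>a<n. \<Sum>c<k. (if a = j then M $$ (I, j * k + c) * P $$ (c, d) else 0))"
    using assms
    by (subst index_mult_mat_sum[OF M kron_carrier[OF one_carrier_mat P]])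
      (auto simp: block_index_less sum_lessThan_mult index_kron[OF one_carrier_mat P] intro!: sum.cong)
  also have "\<dots> = (\<Sum>a<n. if a = j then (\<Sum>c<k. M $$ (I, j * k + c) * P $$ (c, d)) else 0)"
    by (intro sum.cong) auto
  finally show ?thesis using assms by simp
qed

lemma kron_one_mult:
  assumes "P \<in> carrier_mat k l" "X \<in> carrier_mat n n" "C \<in> carrier_mat l q"
  shows "kron (1\<^sub>m n) P * kron X C = kron X (P * C)"
  using assms kron_mult[OF one_carrier_mat[of n] assms(1,2,3)] by simp

lemma mult_kron_one:
  assumes "P \<in> carrier_mat k l" "X \<in> carrier_mat n n" "C \<in> carrier_mat q k"
  shows "kron X C * kron (1\<^sub>m n) P = kron X (C * P)"
  using assms kron_mult[OF assms(2,3) one_carrier_mat[of n] assms(1)] by simp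

lemma kron_one_right: "X \<in> carrier_mat n n \<Longrightarrow> kron X (1\<^sub>m 1) = X"
  by (intro eq_matI) (auto simp: kron_def)

lemma kron_zero_right: "X \<in> carrier_mat m n \<Longrightarrow> kron X (0\<^sub>m k l) = 0\<^sub>m (m * k) (n * l)"
  by (intro eq_block_matI[of _ m k n l]) (auto simp: index_kron[of _ m n _ k l] block_index_less)

text \<open>With the small factor on the right, the indexing of \<open>eval_poly_mat\<close> gives
  \<open>\<delta>(x \<otimes> C) = \<delta>(x) \<otimes> C\<close> for idempotent \<open>C\<close> exactly, with no permutation of rows and columns.\<close>

definition tuple_kron :: "'d mat_tuple \<Rightarrow> complex mat \<Rightarrow> 'd mat_tuple" where
  "tuple_kron x C = (\<lambda>r. kron (x r) C)"

lemma tuple_kron_in_tuples: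
  "x \<in> tuples n \<Longrightarrow> C \<in> carrier_mat k k \<Longrightarrow> tuple_kron x C \<in> tuples (n * k)"
  by (auto simp: tuples_def tuple_kron_def)

text \<open>With \<open>tuple_kron_zero\<close> this presents \<open>x\<close> and the zero tuple as
  dilations of \<open>x\<close> by the 1-by-1 matrices 1 and 0. Eigenvectors for the eigenvalues 1
  and 0 of a small matrix then act as intertwiners from \<open>x\<close> and from the zero
  tuple.\<close>

lemma tuple_kron_one: "x \<in> tuples n \<Longrightarrow> tuple_kron x (1\<^sub>m 1) = x"
  unfolding tuples_def tuple_kron_def by (intro ext kron_one_right) auto

lemma tuple_kron_zero:
  "x \<in> tuples n \<Longrightarrow> tuple_kron x (0\<^sub>m k k) = zero_tuple (n * k)"
  by (auto simp: tuples_def tuple_kron_def zero_tuple_def kron_zero_right)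

lemma tuple_norm_kron_le:
  assumes "x \<in> tuples n" "C \<in> carrier_mat k k" "op_norm C \<le> g"
  shows "tuple_norm (tuple_kron x C) \<le> tuple_norm x * g"
proof (rule tuple_norm_leI)
  fix r
  have "op_norm (kron (x r) C) \<le> op_norm (x r) * op_norm C"
    using assms by (intro op_norm_kron_le) (auto simp: tuples_def)
  also have "\<dots> \<le> tuple_norm x * g"
    using assms by (intro mult_mono op_norm_le_tuple_norm op_norm_nonneg tuple_norm_nonneg)
  finally show "op_norm (tuple_kron x C r) \<le> tuple_norm x * g" by (simp add: tuple_kron_def)
qed

section \<open>Free polynomials evaluated at dilated tuples\<close>

lemma eval_word_carrier: "x \<in> tuples n \<Longrightarrow> eval_word n w x \<in> carrier_mat n n"
proof (induction w)
  case (Cons r w)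
  then have "x r \<in> carrier_mat n n" "eval_word n w x \<in> carrier_mat n n"
    by (auto simp: tuples_def)
  then show ?case by (simp add: eval_word_def)
qed (simp add: eval_word_def)

lemma eval_word_zero_tuple:
  "w \<noteq> [] \<Longrightarrow> eval_word n w (zero_tuple n) = 0\<^sub>m n n"
proof (cases w)
  case (Cons r v)
  have "eval_word n v (zero_tuple n) \<in> carrier_mat n n"
    by (rule eval_word_carrier) (simp add: tuples_def zero_tuple_def)
  then show ?thesis using Cons by (simp add: eval_word_def zero_tuple_def)
qed simp

text \<open>At the zero tuple every nonempty word vanishes, so the constant coefficient is the whole
  value; level 1 is enough to read it off.\<close>

lemma lookup_Nil_eq_0:
  assumes "eval_poly 1 p (zero_tuple 1) = 0\<^sub>m 1 1"
  shows "Poly_Mapping.lookup p [] = 0"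
proof -
  have "0 = (\<Sum>w\<in>Poly_Mapping.keys p. Poly_Mapping.lookup p w * (eval_word 1 w (zero_tuple 1) $$ (0, 0)))"
    using arg_cong[OF assms, of "\<lambda>M. M $$ (0, 0)"] by (simp add: eval_poly_def)
  also have "\<dots> = (\<Sum>w\<in>Poly_Mapping.keys p. if w = [] then Poly_Mapping.lookup p [] else 0)"
    by (intro sum.cong refl) (auto simp: eval_word_zero_tuple simp del: One_nat_def, simp add: eval_word_def)
  also have "\<dots> = Poly_Mapping.lookup p []"
    by (simp add: in_keys_iff)
  finally show ?thesis by simp
qed

text \<open>A word of length \<open>l\<close> produces the power \<open>C^l\<close>, which
  idempotence collapses to \<open>C\<close>. The empty word is excluded because it yields the
  identity instead of \<open>kron (1\<^sub>m n) C\<close>.\<close>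

lemma eval_word_kron:
  assumes x: "x \<in> tuples n" and C: "C \<in> carrier_mat k k" "C * C = C" and "w \<noteq> []"
  shows "eval_word (n * k) w (tuple_kron x C) = kron (eval_word n w x) C"
  using \<open>w \<noteq> []\<close>
proof (induction w rule: list_nonempty_induct)
  case (single r)
  have "x r \<in> carrier_mat n n" using x by (simp add: tuples_def)
  then show ?case
    using C(1) by (simp add: eval_word_def tuple_kron_def right_mult_one_mat[OF kron_carrier])
next
  case (cons r w)
  have X: "x r \<in> carrier_mat n n" using x by (simp add: tuples_def)
  have "eval_word (n * k) (r # w) (tuple_kron x C) = kron (x r) C * kron (eval_word n w x) C"
    using cons by (simp add: eval_word_def tuple_kron_def)
  also have "\<dots> = kron (x r * eval_word n w x) C"
    using kron_mult[OF X C(1) eval_word_carrier[OF x] C(1)] C(2) by simp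
  finally show ?case by (simp add: eval_word_def)
qed

lemma eval_poly_kron:
  assumes x: "x \<in> tuples n" and C: "C \<in> carrier_mat k k" "C * C = C"
    and p: "Poly_Mapping.lookup p [] = 0"
  shows "eval_poly (n * k) p (tuple_kron x C) = kron (eval_poly n p x) C"
proof (rule eq_block_matI[of _ n k n k])
  have E: "eval_poly n p x \<in> carrier_mat n n" by (simp add: eval_poly_def)
  show "eval_poly (n * k) p (tuple_kron x C) \<in> carrier_mat (n * k) (n * k)"
    by (simp add: eval_poly_def)
  show "kron (eval_poly n p x) C \<in> carrier_mat (n * k) (n * k)"
    using E C by simp
  fix i c j d assume ij: "i < n" "c < k" "j < n" "d < k"
  have "eval_poly (n * k) p (tuple_kron x C) $$ (i * k + c, j * k + d) =
      (\<Sum>w\<in>Poly_Mapping.keys p. Poly_Mapping.lookup p w *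
        (eval_word (n * k) w (tuple_kron x C) $$ (i * k + c, j * k + d)))"
    using ij by (simp add: eval_poly_def block_index_less)
  also have "\<dots> = (\<Sum>w\<in>Poly_Mapping.keys p. Poly_Mapping.lookup p w *
        (eval_word n w x $$ (i, j) * C $$ (c, d)))"
  proof (intro sum.cong refl)
    fix w assume "w \<in> Poly_Mapping.keys p"
    then have "w \<noteq> []" using p by (auto simp: in_keys_iff)
    then show "Poly_Mapping.lookup p w *
        (eval_word (n * k) w (tuple_kron x C) $$ (i * k + c, j * k + d)) =
        Poly_Mapping.lookup p w * (eval_word n w x $$ (i, j) * C $$ (c, d))"
      using ij by (simp add: eval_word_kron[OF x C] index_kron[OF eval_word_carrier[OF x] C(1)])
  qed
  also have "\<dots> = eval_poly n p x $$ (i, j) * C $$ (c, d)"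
    using ij by (simp add: eval_poly_def sum_distrib_right mult.assoc)
  finally show "eval_poly (n * k) p (tuple_kron x C) $$ (i * k + c, j * k + d) =
      kron (eval_poly n p x) C $$ (i * k + c, j * k + d)"
    using ij by (simp add: index_kron[OF E C(1)])
qed

text \<open>An index of the dilated \<open>\<delta>\<close>-matrix encodes an entry of
  \<open>\<delta>\<close>, a row or column of \<open>x\<close> and one of \<open>C\<close>. These
  equations show that splitting off \<open>C\<close> first or \<open>\<delta>\<close> first gives
  the same three numbers.\<close>

lemma block_index_div_mod:
  fixes i :: nat
  assumes "c < k"
  shows "(i * k + c) div (n * k) = i div n" "(i * k + c) mod (n * k) = (i mod n) * k + c"
proof -
  have "(i * k + c) div (n * k) = (i * k + c) div k div n"
    by (metis div_mult2_eq mult.commute)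
  then show "(i * k + c) div (n * k) = i div n" using assms by simp
  have "(i * k + c) mod (k * n) = k * ((i * k + c) div k mod n) + (i * k + c) mod k"
    by (rule mod_mult2_eq)
  then show "(i * k + c) mod (n * k) = (i mod n) * k + c"
    using assms by (simp add: mult.commute)
qed

lemma eval_poly_mat_kron:
  assumes x: "x \<in> tuples n" and C: "C \<in> carrier_mat k k" "C * C = C"
    and \<delta>: "\<delta> \<in> carrier_mat s r"
    and zero: "\<And>a b. a < s \<Longrightarrow> b < r \<Longrightarrow> Poly_Mapping.lookup (\<delta> $$ (a, b)) [] = 0"
  shows "eval_poly_mat (n * k) \<delta> (tuple_kron x C) = kron (eval_poly_mat n \<delta> x) C"
proof (rule eq_block_matI[of _ "s * n" k "r * n" k])
  have E: "eval_poly_mat n \<delta> x \<in> carrier_mat (s * n) (r * n)"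
    using \<delta> by (simp add: eval_poly_mat_def)
  show "eval_poly_mat (n * k) \<delta> (tuple_kron x C) \<in> carrier_mat (s * n * k) (r * n * k)"
    using \<delta> by (simp add: eval_poly_mat_def mult.assoc)
  show "kron (eval_poly_mat n \<delta> x) C \<in> carrier_mat (s * n * k) (r * n * k)"
    using E C by simp
  fix i c j d assume ij: "i < s * n" "c < k" "j < r * n" "d < k"
  then have "n > 0" by (auto intro: Nat.gr0I)
  with ij have ab: "i div n < s" "j div n < r" "i mod n < n" "j mod n < n"
    by (auto simp: less_mult_imp_div_less)
  have P: "eval_poly n p x \<in> carrier_mat n n" for p by (simp add: eval_poly_def)
  have "eval_poly_mat (n * k) \<delta> (tuple_kron x C) $$ (i * k + c, j * k + d) =
      kron (eval_poly n (\<delta> $$ (i div n, j div n)) x) C $$ ((i mod n) * k + c, (j mod n) * k + d)"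
    using ij \<delta> block_index_less[OF ij(1,2)] block_index_less[OF ij(3,4)]
    by (simp add: eval_poly_mat_def block_index_div_mod mult.assoc
        eval_poly_kron[OF x C zero] ab)
  also have "\<dots> = eval_poly_mat n \<delta> x $$ (i, j) * C $$ (c, d)"
    using ij ab \<delta> by (simp add: index_kron[OF P C(1)] eval_poly_mat_def)
  finally show "eval_poly_mat (n * k) \<delta> (tuple_kron x C) $$ (i * k + c, j * k + d) =
      kron (eval_poly_mat n \<delta> x) C $$ (i * k + c, j * k + d)"
    using ij by (simp add: index_kron[OF E C(1)])
qed

section \<open>Intertwining and the Schwarz estimate\<close>

text \<open>Any single component determines the size, and there is one because the index type is
  nonempty.\<close>

lemma tuples_unique: "x \<in> tuples n \<Longrightarrow> x \<in> tuples m \<Longrightarrow> m = n"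
  by (auto simp: tuples_def) (metis carrier_matD(1))

lemma B_set_level: "x \<in> B_set \<delta> \<Longrightarrow> x \<in> tuples n \<Longrightarrow> x \<in> B_level \<delta> n"
  using tuples_unique by (fastforce simp: B_set_def B_level_def)

lemma B_level_subset: "n \<ge> 1 \<Longrightarrow> B_level \<delta> n \<subseteq> B_set \<delta> \<inter> tuples n"
  by (auto simp: B_set_def B_level_def)

lemma nc_function_carrier:
  "nc_function \<Omega> f \<Longrightarrow> n \<ge> 1 \<Longrightarrow> x \<in> \<Omega> \<inter> tuples n \<Longrightarrow> f x \<in> carrier_mat n n"
  by (auto simp: nc_function_def)

text \<open>The nc axiom for \<open>\<alpha> = kron (1\<^sub>m n) P\<close>, read off entry by
  entry. Both levels are at least 1 because the given indices exist.\<close>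

lemma nc_function_intertwine:
  assumes f: "nc_function \<Omega> f" and x: "x \<in> \<Omega> \<inter> tuples (n * k)" and y: "y \<in> \<Omega> \<inter> tuples (n * l)"
    and P: "P \<in> carrier_mat l k"
    and eq: "\<And>r. kron (1\<^sub>m n) P * x r = y r * kron (1\<^sub>m n) P"
    and ij: "i < n" "c < l" "j < n" "d < k"
  shows "(\<Sum>e<k. P $$ (c, e) * f x $$ (i * k + e, j * k + d)) =
    (\<Sum>e<l. f y $$ (i * l + c, j * l + e) * P $$ (e, d))"
proof -
  have pos: "n * k \<ge> 1" "n * l \<ge> 1" using ij by auto
  have F: "f x \<in> carrier_mat (n * k) (n * k)" "f y \<in> carrier_mat (n * l) (n * l)"
    using nc_function_carrier[OF f] pos x y by auto
  have "kron (1\<^sub>m n) P * f x = f y * kron (1\<^sub>m n) P"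
    using f pos x y eq kron_carrier[OF one_carrier_mat P, of n] unfolding nc_function_def by blast
  then have "(kron (1\<^sub>m n) P * f x) $$ (i * l + c, j * k + d) =
      (f y * kron (1\<^sub>m n) P) $$ (i * l + c, j * k + d)" by simp
  then show ?thesis
    using index_kron_one_mult[OF P F(1)] index_mult_kron_one[OF P F(2)] ij
    by (simp add: block_index_less)
qed

text \<open>For two dilations of the same tuple, the relation between tuples reduces to
  \<open>P * C = D * P\<close> between small matrices.\<close>

lemma nc_function_kron_intertwine:
  assumes f: "nc_function \<Omega> f" and x: "x \<in> tuples n"
    and C: "C \<in> carrier_mat k k" "tuple_kron x C \<in> \<Omega>"
    and D: "D \<in> carrier_mat l l" "tuple_kron x D \<in> \<Omega>"
    and P: "P \<in> carrier_mat l k" "P * C = D * P"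
    and ij: "i < n" "c < l" "j < n" "d < k"
  shows "(\<Sum>e<k. P $$ (c, e) * f (tuple_kron x C) $$ (i * k + e, j * k + d)) =
    (\<Sum>e<l. f (tuple_kron x D) $$ (i * l + c, j * l + e) * P $$ (e, d))"
proof (rule nc_function_intertwine[OF f])
  show "kron (1\<^sub>m n) P * tuple_kron x C r = tuple_kron x D r * kron (1\<^sub>m n) P" for r
    using x P C D kron_one_mult[of P l k "x r" n C k] mult_kron_one[of P l k "x r" n D l]
    by (simp add: tuple_kron_def tuples_def)
qed (use assms tuple_kron_in_tuples in auto)

section \<open>The dilating idempotent and the Schwarz step\<close>

lemmas small_index_simps = lessThan_Suc numeral_2_eq_2 numeral_3_eq_3 less_Suc_eq

definition idem2 :: "real \<Rightarrow> complex mat" where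
  "idem2 t = mat 2 2 (\<lambda>(c, d). if d = 0 then 0 else if c = 0 then of_real t else 1)"

definition col2 :: "real \<Rightarrow> complex mat" where
  "col2 t = mat 2 1 (\<lambda>(c, d). if c = 0 then of_real t else 1)"

lemma idem2_carrier [simp]: "idem2 t \<in> carrier_mat 2 2" by (simp add: idem2_def)
lemma col2_carrier [simp]: "col2 t \<in> carrier_mat 2 1" by (simp add: col2_def)

lemma idem2_idem: "idem2 t * idem2 t = idem2 t"
  by (rule eq_matI) (auto simp: idem2_def scalar_prod_def small_index_simps)

text \<open>Only the second coordinate of the vector contributes, and the nonzero column has squared
  length \<open>1 + t\<^sup>2\<close>.\<close>

lemma op_norm_idem2_le: "op_norm (idem2 t) \<le> sqrt (1 + t\<^sup>2)"
proof (rule op_norm_leI[OF idem2_carrier])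
  fix v :: "nat \<Rightarrow> complex"
  have "(\<Sum>i<2. (cmod (\<Sum>j<2. idem2 t $$ (i, j) * v j))\<^sup>2) = (1 + t\<^sup>2) * (cmod (v 1))\<^sup>2"
    by (simp add: idem2_def small_index_simps norm_mult power_mult_distrib algebra_simps)
  also have "\<dots> \<le> (1 + t\<^sup>2) * (\<Sum>j<2. (cmod (v j))\<^sup>2)"
    by (intro mult_left_mono) (auto simp: small_index_simps)
  finally show "(\<Sum>i<2. (cmod (\<Sum>j<2. idem2 t $$ (i, j) * v j))\<^sup>2) \<le>
    (sqrt (1 + t\<^sup>2))\<^sup>2 * (\<Sum>j<2. (cmod (v j))\<^sup>2)" by simp
qed simp

text \<open>Each coordinate of \<open>A v\<close> occurs in the image of \<open>v\<close> twice,
  multiplied by \<open>t\<close> and by 1, so lengths grow by exactly \<open>g\<close>.\<close>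

lemma op_norm_kron_col2_ge:
  assumes A: "A \<in> carrier_mat m n"
  shows "sqrt (1 + t\<^sup>2) * op_norm A \<le> op_norm (kron A (col2 t))"
proof -
  define g where "g = sqrt (1 + t\<^sup>2)"
  have g: "g > 0" "g\<^sup>2 = 1 + t\<^sup>2" by (simp_all add: g_def add_pos_nonneg)
  have K: "kron A (col2 t) \<in> carrier_mat (m * 2) n"
    using kron_carrier[OF A col2_carrier[of t]] by simp
  have KI: "kron A (col2 t) $$ (i * 2 + c, j) = A $$ (i, j) * col2 t $$ (c, 0)"
    if "i < m" "c < 2" "j < n" for i c j
    using index_kron[OF A col2_carrier that, of 0 t] by simp
  have "op_norm A \<le> op_norm (kron A (col2 t)) / g"
  proof (rule op_norm_leI[OF A])
    show "0 \<le> op_norm (kron A (col2 t)) / g" using g op_norm_nonneg by simp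
    fix v :: "nat \<Rightarrow> complex"
    have "(1 + t\<^sup>2) * (\<Sum>i<m. (cmod (\<Sum>j<n. A $$ (i, j) * v j))\<^sup>2) =
        (\<Sum>i<m. \<Sum>c<2. (cmod (col2 t $$ (c, 0) * (\<Sum>j<n. A $$ (i, j) * v j)))\<^sup>2)"
      by (simp add: sum_distrib_left col2_def small_index_simps norm_mult power_mult_distrib algebra_simps)
    also have "\<dots> = (\<Sum>I<m * 2. (cmod (\<Sum>j<n. kron A (col2 t) $$ (I, j) * v j))\<^sup>2)"
      by (simp add: sum_lessThan_mult KI sum_distrib_left mult_ac)
    also have "\<dots> \<le> (op_norm (kron A (col2 t)))\<^sup>2 * (\<Sum>j<n. (cmod (v j))\<^sup>2)"
      by (rule op_norm_bound[OF K])
    finally show "(\<Sum>i<m. (cmod (\<Sum>j<n. A $$ (i, j) * v j))\<^sup>2) \<le>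
        (op_norm (kron A (col2 t)) / g)\<^sup>2 * (\<Sum>j<n. (cmod (v j))\<^sup>2)"
      using g by (simp add: power_divide field_simps add_pos_nonneg)
  qed
  then show ?thesis using g by (simp add: g_def[symmetric] field_simps)
qed

text \<open>The columns \<open>(t, 1)\<^sup>T\<close> and \<open>(1, 0)\<^sup>T\<close> are eigenvectors of \<open>idem2 t\<close> for the eigenvalues
  1 and 0; intertwining along them determines \<open>f(x \<otimes> idem2 t) = f(x) \<otimes> idem2 t\<close>.\<close>

lemma nc_schwarz_step:
  assumes f: "nc_function \<Omega> f" and n: "n \<ge> 1"
    and x: "x \<in> \<Omega> \<inter> tuples n" and y: "tuple_kron x (idem2 t) \<in> \<Omega>"
    and zero: "zero_tuple n \<in> \<Omega>" "f (zero_tuple n) = 0\<^sub>m n n"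
  shows "sqrt (1 + t\<^sup>2) * op_norm (f x) \<le> op_norm (f (tuple_kron x (idem2 t)))"
proof -
  define F where "F = f (tuple_kron x (idem2 t))"
  define E where "E = mat 2 1 (\<lambda>(c, d). if c = 0 then 1 else 0 :: complex)"
  have xt: "x \<in> tuples n" using x by simp
  have E: "E \<in> carrier_mat 2 1" by (simp add: E_def)
  have F: "F \<in> carrier_mat (n * 2) (n * 2)"
    unfolding F_def using n y tuple_kron_in_tuples[OF xt idem2_carrier]
    by (intro nc_function_carrier[OF f]) auto
  have fx: "f x \<in> carrier_mat n n" using nc_function_carrier[OF f n x] .
  have x1: "tuple_kron x (1\<^sub>m 1) = x" using tuple_kron_one xt by blast
  have x0: "tuple_kron x (0\<^sub>m 1 1) = zero_tuple n" using tuple_kron_zero[OF xt, of 1] by simp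
  have eq0: "E * 0\<^sub>m 1 1 = idem2 t * E" "col2 t * 1\<^sub>m 1 = idem2 t * col2 t"
    by (rule eq_matI; auto simp: E_def idem2_def col2_def scalar_prod_def small_index_simps)+
  have col: "F $$ (i * 2 + c, j * 2 + 1) = f x $$ (i, j) * col2 t $$ (c, 0)"
    if ij: "i < n" "c < 2" "j < n" for i c j
  proof -
    \<comment> \<open>Intertwining along \<open>E\<close> equates the first block column of
      \<open>F\<close> with a multiple of the value of \<open>f\<close> at the zero tuple.\<close>
    have "F $$ (i * 2 + c, j * 2) = 0"
      using nc_function_kron_intertwine[OF f xt _ _ idem2_carrier y E eq0(1), of i c j 0] ij zero
      by (simp add: x0[simplified] F_def[symmetric] small_index_simps E_def)
    then show ?thesis
      using nc_function_kron_intertwine[OF f xt _ _ idem2_carrier y col2_carrier eq0(2), of i c j 0] ij x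
      by (simp add: x1[simplified] F_def[symmetric] lessThan_Suc numeral_2_eq_2)
        (simp add: col2_def mult.commute)
  qed
  \<comment> \<open>The second block column occupies the odd column indices of \<open>F\<close>; the
    map \<open>id\<close> on rows matches the form of \<open>op_norm_submatrix_le\<close>.\<close>
  have "kron (f x) (col2 t) = mat (n * 2) n (\<lambda>(i, j). F $$ (id i, j * 2 + 1))"
  proof (rule eq_block_matI[of _ n 2 n 1])
    show "kron (f x) (col2 t) \<in> carrier_mat (n * 2) (n * 1)" by (intro kron_carrier fx col2_carrier)
    fix i c j d :: nat assume ij: "i < n" "c < 2" "j < n" "d < 1"
    show "kron (f x) (col2 t) $$ (i * 2 + c, j * 1 + d) =
      mat (n * 2) n (\<lambda>(i, j). F $$ (id i, j * 2 + 1)) $$ (i * 2 + c, j * 1 + d)"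
      using ij col[OF ij(1-3)] block_index_less[OF ij(1,2)]
      by (subst index_kron[OF fx col2_carrier]) auto
  qed simp
  then have "op_norm (kron (f x) (col2 t)) \<le> op_norm F"
    using op_norm_submatrix_le[OF F, of id "n * 2" "\<lambda>j. j * 2 + 1" n]
    by (auto simp: inj_on_def image_subset_iff)
  then show ?thesis
    using op_norm_kron_col2_ge[OF fx, of t] by (simp add: F_def)
qed

text \<open>If \<open>\<rho> < m < \<phi>\<close>, take \<open>t\<close> with
  \<open>sqrt (1 + t\<^sup>2) = 1 / m\<close>: the premise of \<open>bound\<close> holds as
  \<open>\<rho> / m < 1\<close>, but its conclusion fails as \<open>\<phi> / m > 1\<close>. Such a
  \<open>t\<close> exists because \<open>\<phi> \<le> 1\<close> forces \<open>m < 1\<close>.\<close>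

lemma le_of_dilation_bounds:
  fixes \<phi> \<rho> :: real
  assumes "0 \<le> \<rho>" "\<phi> \<le> 1" and bound: "\<And>t. sqrt (1 + t\<^sup>2) * \<rho> < 1 \<Longrightarrow> sqrt (1 + t\<^sup>2) * \<phi> \<le> 1"
  shows "\<phi> \<le> \<rho>"
proof (rule ccontr)
  assume "\<not> \<phi> \<le> \<rho>"
  then obtain m where m: "\<rho> < m" "m < \<phi>" using dense[of \<rho> \<phi>] by auto
  then have m01: "0 < m" "m < 1" using assms by auto
  define t where "t = sqrt ((1 / m)\<^sup>2 - 1)"
  have "1 \<le> (1 / m)\<^sup>2" using m01 by (intro one_le_power) simp
  then have "sqrt (1 + t\<^sup>2) = 1 / m" using m01 by (simp add: t_def real_sqrt_divide)
  then show False using bound[of t] m m01 by simp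
qed

lemma RSA_schwarz:
  assumes \<delta>: "\<delta> \<in> carrier_mat s r"
    and zero: "\<And>n. n \<ge> 1 \<Longrightarrow> eval_poly_mat n \<delta> (zero_tuple n) = 0\<^sub>m (s * n) (r * n)"
    and f: "f \<in> RSA \<delta>" and n: "n \<ge> 1" and x: "x \<in> B_level \<delta> n"
  shows "op_norm (f x) \<le> op_norm (eval_poly_mat n \<delta> x)"
proof (rule le_of_dilation_bounds)
  have xt: "x \<in> tuples n" and xB: "x \<in> B_set \<delta>" using x n B_level_subset by auto
  have nc: "nc_function (B_set \<delta>) f" and bound: "\<And>x. x \<in> B_set \<delta> \<Longrightarrow> op_norm (f x) \<le> 1"
    and f0: "f (zero_tuple n) = 0\<^sub>m n n" using f n by (auto simp: RSA_def)
  have "op_norm (0\<^sub>m k l) < 1" for k l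
    by (rule le_less_trans[OF op_norm_leI[of _ k l 0]]) auto
  then have "zero_tuple n \<in> B_level \<delta> n"
    using zero[OF n] by (auto simp: B_level_def tuples_def zero_tuple_def)
  then have z: "zero_tuple n \<in> B_set \<delta>" using n B_level_subset by auto
  \<comment> \<open>At level 1 the blocks of \<open>\<delta>(0)\<close> are single entries, so the
    hypothesis at \<open>n = 1\<close> gives each constant coefficient.\<close>
  have Nil: "Poly_Mapping.lookup (\<delta> $$ (a, b)) [] = 0" if ab: "a < s" "b < r" for a b
  proof (rule lookup_Nil_eq_0, rule eq_matI)
    fix i j assume "i < dim_row (0\<^sub>m 1 1 :: complex mat)" "j < dim_col (0\<^sub>m 1 1 :: complex mat)"
    then show "eval_poly 1 (\<delta> $$ (a, b)) (zero_tuple 1) $$ (i, j) = 0\<^sub>m 1 1 $$ (i, j)"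
      using arg_cong[OF zero[of 1], of "\<lambda>M. M $$ (a, b)"] ab \<delta> by (simp add: eval_poly_mat_def)
  qed (simp_all add: eval_poly_def)
  have D: "eval_poly_mat n \<delta> x \<in> carrier_mat (s * n) (r * n)"
    using \<delta> by (simp add: eval_poly_mat_def)
  show "0 \<le> op_norm (eval_poly_mat n \<delta> x)" by (rule op_norm_nonneg)
  show "op_norm (f x) \<le> 1" using bound xB .
  fix t :: real
  assume t: "sqrt (1 + t\<^sup>2) * op_norm (eval_poly_mat n \<delta> x) < 1"
  have "eval_poly_mat (n * 2) \<delta> (tuple_kron x (idem2 t)) = kron (eval_poly_mat n \<delta> x) (idem2 t)"
    by (intro eval_poly_mat_kron[OF xt idem2_carrier idem2_idem \<delta>] Nil)
  then have "op_norm (eval_poly_mat (n * 2) \<delta> (tuple_kron x (idem2 t))) \<le>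
      op_norm (eval_poly_mat n \<delta> x) * op_norm (idem2 t)"
    using op_norm_kron_le[OF D idem2_carrier] by simp
  also have "\<dots> \<le> op_norm (eval_poly_mat n \<delta> x) * sqrt (1 + t\<^sup>2)"
    by (intro mult_left_mono op_norm_idem2_le op_norm_nonneg)
  finally have "tuple_kron x (idem2 t) \<in> B_level \<delta> (n * 2)"
    using t tuple_kron_in_tuples[OF xt idem2_carrier] by (simp add: B_level_def mult.commute)
  then have y: "tuple_kron x (idem2 t) \<in> B_set \<delta>"
    using n B_level_subset[of "n * 2" \<delta>] by auto
  show "sqrt (1 + t\<^sup>2) * op_norm (f x) \<le> 1"
    using nc_schwarz_step[OF nc n _ y z f0] xt xB bound[OF y] by fastforce
qed

section \<open>The derivative at the origin\<close>

definition nilp2 :: "complex mat" where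
  "nilp2 = mat 2 2 (\<lambda>(c, d). if c = 0 \<and> d = 1 then 1 else 0)"

lemma nilp2_carrier [simp]: "nilp2 \<in> carrier_mat 2 2" by (simp add: nilp2_def)

lemma op_norm_unit_mat_le:
  assumes "p < m" "q < n"
  shows "op_norm (mat m n (\<lambda>(c, d). if c = p \<and> d = q then 1 else 0)) \<le> 1"
proof (rule op_norm_leI[OF mat_carrier])
  fix v :: "nat \<Rightarrow> complex"
  have "(\<Sum>i<m. (cmod (\<Sum>j<n. mat m n (\<lambda>(c, d). if c = p \<and> d = q then 1 else 0) $$ (i, j) * v j))\<^sup>2) =
      (\<Sum>i<m. if i = p then (cmod (v q))\<^sup>2 else 0)"
  proof -
    have "(\<Sum>j<n. (if j = q then 1 else 0) * v j) = (\<Sum>j<n. if j = q then v j else 0)"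
      by (intro sum.cong) auto
    then have "(\<Sum>j<n. (if j = q then 1 else 0) * v j) = v q" using assms by simp
    then show ?thesis using assms by (intro sum.cong refl) auto
  qed
  also have "\<dots> = (cmod (v q))\<^sup>2" using assms by simp
  also have "\<dots> \<le> (\<Sum>j<n. (cmod (v j))\<^sup>2)"
    using assms by (intro member_le_sum) auto
  finally show "(\<Sum>i<m. (cmod (\<Sum>j<n. mat m n (\<lambda>(c, d). if c = p \<and> d = q then 1 else 0) $$ (i, j) * v j))\<^sup>2) \<le>
    1\<^sup>2 * (\<Sum>j<n. (cmod (v j))\<^sup>2)" by simp
qed simp

lemma op_norm_nilp2_le: "op_norm nilp2 \<le> 1"
  unfolding nilp2_def by (rule op_norm_unit_mat_le) auto

text \<open>Here \<open>\<delta>\<close> survives only through the requirement that the domain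
  contain the polydisc, so membership in the domain can be checked by \<open>tuple_norm\<close>
  alone.\<close>

locale nc_polydisc_map =
  fixes \<Omega> :: "'d::finite mat_tuple set" and f :: "'d mat_tuple \<Rightarrow> complex mat"
  assumes nc: "nc_function \<Omega> f"
    and bound: "x \<in> \<Omega> \<Longrightarrow> op_norm (f x) \<le> 1"
    and zero: "n \<ge> 1 \<Longrightarrow> f (zero_tuple n) = 0\<^sub>m n n"
    and polydisc: "n \<ge> 1 \<Longrightarrow> x \<in> tuples n \<Longrightarrow> tuple_norm x < 1 \<Longrightarrow> x \<in> \<Omega>"
begin

lemma kron_in_domain:
  assumes "n \<ge> 1" "x \<in> tuples n" "k \<ge> 1" "C \<in> carrier_mat k k" "op_norm C \<le> g" "tuple_norm x * g < 1"
  shows "tuple_kron x C \<in> \<Omega>"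
  using assms tuple_norm_kron_le[of x n C k g]
  by (intro polydisc[of "n * k"]) (auto simp: tuple_kron_in_tuples)

lemma zero_in_domain: "n \<ge> 1 \<Longrightarrow> zero_tuple n \<in> \<Omega>"
  by (rule polydisc) (auto simp: tuples_def zero_tuple_def tuple_norm_def
      intro!: le_less_trans[OF op_norm_leI[of _ n n 0]])

lemma schwarz:
  assumes n: "n \<ge> 1" and x: "x \<in> tuples n" "tuple_norm x < 1"
  shows "op_norm (f x) \<le> tuple_norm x"
proof (rule le_of_dilation_bounds)
  have xO: "x \<in> \<Omega>" using polydisc n x .
  show "0 \<le> tuple_norm x" by (rule tuple_norm_nonneg)
  show "op_norm (f x) \<le> 1" using bound xO .
  fix t assume "sqrt (1 + t\<^sup>2) * tuple_norm x < 1"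
  then have y: "tuple_kron x (idem2 t) \<in> \<Omega>"
    using kron_in_domain[OF n x(1) _ idem2_carrier op_norm_idem2_le] by (simp add: mult.commute)
  show "sqrt (1 + t\<^sup>2) * op_norm (f x) \<le> 1"
    using nc_schwarz_step[OF nc n _ y zero_in_domain[OF n] zero[OF n]] xO x bound[OF y] by fastforce
qed

text \<open>For \<open>h\<close> in the polydisc this is the nc difference-differential of
  \<open>f\<close> at the pair \<open>(0, 0)\<close> in direction \<open>h\<close>. Block
  \<open>(0, 1)\<close> sits at even rows and odd columns since the small factor is on the
  right.\<close>

definition upper :: "nat \<Rightarrow> 'd mat_tuple \<Rightarrow> complex mat" where
  "upper n h = mat n n (\<lambda>(i, j). f (tuple_kron h nilp2) $$ (i * 2, j * 2 + 1))"

text \<open>By homogeneity of \<open>upper\<close> the value does not depend on the scaling factor; the factor chosen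
  here only keeps the argument in the polydisc.\<close>

definition deriv0 :: "nat \<Rightarrow> 'd mat_tuple \<Rightarrow> complex mat" where
  "deriv0 n h = complex_of_real (2 * (1 + tuple_norm h)) \<cdot>\<^sub>m
     upper n (\<lambda>r. complex_of_real (1 / (2 * (1 + tuple_norm h))) \<cdot>\<^sub>m h r)"

lemma upper_carrier [simp]: "upper n h \<in> carrier_mat n n" by (simp add: upper_def)
lemma deriv0_carrier [simp]: "deriv0 n h \<in> carrier_mat n n" by (simp add: deriv0_def)

lemma nilp2_in_domain:
  "n \<ge> 1 \<Longrightarrow> h \<in> tuples n \<Longrightarrow> tuple_norm h < 1 \<Longrightarrow> tuple_kron h nilp2 \<in> \<Omega>"
  using kron_in_domain[OF _ _ _ nilp2_carrier op_norm_nilp2_le] by simp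

text \<open>One point \<open>Y\<close> of size \<open>3 n\<close> contains both directions, and the
  matrix \<open>P\<close> with rows \<open>(a, b, 0)\<close> and \<open>(0, 0, 1)\<close>
  intertwines it with the dilation of \<open>a h + b k\<close> by \<open>nilp2\<close>. The bounds
  \<open>1 / 2\<close> keep \<open>Y\<close> in the polydisc.\<close>

lemma upper_linear:
  assumes n: "n \<ge> 1" and h: "h \<in> tuples n" "tuple_norm h < 1 / 2" and k: "k \<in> tuples n" "tuple_norm k < 1 / 2"
    and z: "tuple_norm (\<lambda>r. \<alpha> \<cdot>\<^sub>m h r + \<beta> \<cdot>\<^sub>m k r) < 1"
  shows "upper n (\<lambda>r. \<alpha> \<cdot>\<^sub>m h r + \<beta> \<cdot>\<^sub>m k r) = \<alpha> \<cdot>\<^sub>m upper n h + \<beta> \<cdot>\<^sub>m upper n k"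
proof -
  define E1 :: "complex mat" where "E1 = mat 3 3 (\<lambda>(c, d). if c = 0 \<and> d = 2 then 1 else 0)"
  define E2 :: "complex mat" where "E2 = mat 3 3 (\<lambda>(c, d). if c = 1 \<and> d = 2 then 1 else 0)"
  have E: "E1 \<in> carrier_mat 3 3" "E2 \<in> carrier_mat 3 3" "op_norm E1 \<le> 1" "op_norm E2 \<le> 1"
    by (simp_all add: E1_def E2_def op_norm_unit_mat_le)
  have hk: "h r \<in> carrier_mat n n" "k r \<in> carrier_mat n n" for r
    using h k by (simp_all add: tuples_def)
  have K1: "kron (h r) E1 \<in> carrier_mat (n * 3) (n * 3)"
    and K2: "kron (k r) E2 \<in> carrier_mat (n * 3) (n * 3)" for r
    using hk E by auto
  define Y where "Y = (\<lambda>r. kron (h r) E1 + kron (k r) E2)"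
  have Yt: "Y \<in> tuples (n * 3)" using K1 K2 by (simp add: tuples_def Y_def)
  have "tuple_norm Y \<le> tuple_norm h + tuple_norm k"
  proof (rule tuple_norm_leI)
    fix r
    have "op_norm (Y r) \<le> op_norm (kron (h r) E1) + op_norm (kron (k r) E2)"
      unfolding Y_def by (rule op_norm_triangle[OF K1 K2])
    also have "\<dots> \<le> op_norm (tuple_kron h E1 r) + op_norm (tuple_kron k E2 r)"
      by (simp add: tuple_kron_def)
    also have "\<dots> \<le> tuple_norm (tuple_kron h E1) + tuple_norm (tuple_kron k E2)"
      by (intro add_mono op_norm_le_tuple_norm)
    also have "\<dots> \<le> tuple_norm h * 1 + tuple_norm k * 1"
      using h k E by (intro add_mono tuple_norm_kron_le)
    finally show "op_norm (Y r) \<le> tuple_norm h + tuple_norm k" by simp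
  qed
  then have Y: "Y \<in> \<Omega> \<inter> tuples (n * 3)"
    using Yt n h k polydisc[of "n * 3" Y] by auto
  have main: "upper n (\<lambda>r. a \<cdot>\<^sub>m h r + b \<cdot>\<^sub>m k r) $$ (i, j) =
      a * f Y $$ (i * 3, j * 3 + 2) + b * f Y $$ (i * 3 + 1, j * 3 + 2)"
    if ij: "i < n" "j < n" and z: "tuple_norm (\<lambda>r. a \<cdot>\<^sub>m h r + b \<cdot>\<^sub>m k r) < 1" for i j a b
  proof -
    define w where "w = (\<lambda>r. a \<cdot>\<^sub>m h r + b \<cdot>\<^sub>m k r)"
    have w: "w \<in> tuples n" using hk by (simp add: w_def tuples_def)
    have wO: "tuple_kron w nilp2 \<in> \<Omega> \<inter> tuples (n * 2)"
      using nilp2_in_domain[OF n w] tuple_kron_in_tuples[OF w nilp2_carrier] z by (simp add: w_def)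
    define P where "P = mat 2 3 (\<lambda>(c, d). if c = 0 then (if d = 0 then a else if d = 1 then b else 0)
        else if d = 2 then 1 else 0)"
    have P: "P \<in> carrier_mat 2 3" by (simp add: P_def)
    \<comment> \<open>Both products are multiples of the same matrix \<open>nilp2 * P\<close>, so
      the two summands of \<open>Y\<close> merge into one Kronecker product with
      \<open>a h + b k\<close>.\<close>
    have PE: "P * E1 = a \<cdot>\<^sub>m (nilp2 * P)" "P * E2 = b \<cdot>\<^sub>m (nilp2 * P)"
      by (rule eq_matI; auto simp: P_def E1_def E2_def nilp2_def scalar_prod_def small_index_simps)+
    have Q: "nilp2 * P \<in> carrier_mat 2 3" by (rule mult_carrier_mat[OF nilp2_carrier P])
    have rel: "kron (1\<^sub>m n) P * Y r = tuple_kron w nilp2 r * kron (1\<^sub>m n) P" for r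
    proof -
      have "kron (1\<^sub>m n) P * Y r = kron (h r) (P * E1) + kron (k r) (P * E2)"
        unfolding Y_def using kron_carrier[OF one_carrier_mat P, of n] K1 K2
        by (simp add: mult_add_distrib_mat[OF _ K1 K2] kron_one_mult[OF P hk(1) E(1)]
            kron_one_mult[OF P hk(2) E(2)])
      also have "\<dots> = kron (w r) (nilp2 * P)"
        unfolding PE w_def
        using hk[of r] Q
        by (intro eq_block_matI[of _ n 2 n 3])
          (auto simp: block_index_less index_kron[of _ n n _ 2 3] distrib_right
            carrier_matD[OF kron_carrier[of _ n n _ 2 3]] carrier_matD[OF Q] simp del: index_mult_mat)
      also have "\<dots> = tuple_kron w nilp2 r * kron (1\<^sub>m n) P"
        using mult_kron_one[OF P _ nilp2_carrier, of "w r" n] w by (simp add: tuple_kron_def tuples_def)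
      finally show ?thesis .
    qed
    show ?thesis
      using nc_function_intertwine[OF nc Y wO P rel ij(1) _ ij(2), of 0 2] ij
      by (simp add: upper_def w_def[symmetric] P_def lessThan_Suc numeral_2_eq_2 numeral_3_eq_3)
        (metis add.commute)
  qed
  \<comment> \<open>The blocks of \<open>f Y\<close> do not depend on \<open>a\<close> and
    \<open>b\<close>; the choices \<open>(1, 0)\<close> and \<open>(0, 1)\<close> in
    \<open>main\<close> identify them with \<open>upper n h\<close> and
    \<open>upper n k\<close>.\<close>
  have h1: "(\<lambda>r. 1 \<cdot>\<^sub>m h r + 0 \<cdot>\<^sub>m k r) = h" and k1: "(\<lambda>r. 0 \<cdot>\<^sub>m h r + 1 \<cdot>\<^sub>m k r) = k"
    using carrier_matD[OF hk(1)] carrier_matD[OF hk(2)] by (auto intro!: ext eq_matI)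
  show ?thesis
  proof (rule eq_matI)
    fix i j assume "i < dim_row (\<alpha> \<cdot>\<^sub>m upper n h + \<beta> \<cdot>\<^sub>m upper n k)"
      "j < dim_col (\<alpha> \<cdot>\<^sub>m upper n h + \<beta> \<cdot>\<^sub>m upper n k)"
    then have ij: "i < n" "j < n" by (simp_all add: upper_def)
    show "upper n (\<lambda>r. \<alpha> \<cdot>\<^sub>m h r + \<beta> \<cdot>\<^sub>m k r) $$ (i, j) =
        (\<alpha> \<cdot>\<^sub>m upper n h + \<beta> \<cdot>\<^sub>m upper n k) $$ (i, j)"
      using main[OF ij z] main[OF ij, of 1 0] main[OF ij, of 0 1] h k ij
        carrier_matD[OF upper_carrier[of n h]] carrier_matD[OF upper_carrier[of n k]]
      by (simp add: h1 k1)
  qed (simp_all add: upper_def)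
qed

text \<open>Both scalings are compared through \<open>g = b h\<close>, with \<open>b\<close> the
  factor in \<open>deriv0\<close>. Its norm is below \<open>1 / 2\<close>, as
  \<open>upper_linear\<close> demands, while \<open>a h = (a / b) g\<close> only has to lie in the
  polydisc.\<close>

lemma deriv0_eq:
  assumes n: "n \<ge> 1" and h: "h \<in> tuples n" and a: "a > 0" "a * tuple_norm h < 1"
  shows "deriv0 n h = complex_of_real (1 / a) \<cdot>\<^sub>m upper n (\<lambda>r. complex_of_real a \<cdot>\<^sub>m h r)"
proof -
  define b where "b = 1 / (2 * (1 + tuple_norm h))"
  have b: "b > 0" "b * tuple_norm h < 1 / 2"
    using tuple_norm_nonneg[of h] by (auto simp: b_def field_simps)
  have hr: "h r \<in> carrier_mat n n" for r using h by (simp add: tuples_def)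
  define g where "g = (\<lambda>r. complex_of_real b \<cdot>\<^sub>m h r)"
  have g: "g \<in> tuples n" "tuple_norm g < 1 / 2"
    using tuple_norm_smult_le[OF h, of "complex_of_real b"] b hr by (auto simp: g_def tuples_def)
  have eq: "(\<lambda>r. complex_of_real (a / b) \<cdot>\<^sub>m g r + 0 \<cdot>\<^sub>m g r) = (\<lambda>r. complex_of_real a \<cdot>\<^sub>m h r)"
    using hr b by (auto simp: g_def intro!: ext eq_matI)
  have "tuple_norm (\<lambda>r. complex_of_real a \<cdot>\<^sub>m h r) < 1"
    using tuple_norm_smult_le[OF h, of "complex_of_real a"] a by simp
  then have "upper n (\<lambda>r. complex_of_real a \<cdot>\<^sub>m h r) =
      complex_of_real (a / b) \<cdot>\<^sub>m upper n g + 0 \<cdot>\<^sub>m upper n g"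
    using upper_linear[OF n g g, of "complex_of_real (a / b)" 0] by (simp only: eq)
  moreover have "deriv0 n h = complex_of_real (1 / b) \<cdot>\<^sub>m upper n g"
    by (simp add: deriv0_def b_def g_def)
  ultimately show ?thesis
    using a b carrier_matD[OF upper_carrier[of n g]] by (auto intro!: eq_matI)
qed

lemma deriv0_combination:
  assumes n: "n \<ge> 1" and h: "h \<in> tuples n" and k: "k \<in> tuples n"
  shows "deriv0 n (\<lambda>r. \<alpha> \<cdot>\<^sub>m h r + \<beta> \<cdot>\<^sub>m k r) = \<alpha> \<cdot>\<^sub>m deriv0 n h + \<beta> \<cdot>\<^sub>m deriv0 n k"
proof -
  define z where "z = (\<lambda>r. \<alpha> \<cdot>\<^sub>m h r + \<beta> \<cdot>\<^sub>m k r)"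
  have hk: "h r \<in> carrier_mat n n" "k r \<in> carrier_mat n n" for r
    using h k by (simp_all add: tuples_def)
  have z: "z \<in> tuples n" using hk by (simp add: z_def tuples_def)
  \<comment> \<open>A common factor that brings \<open>h\<close>, \<open>k\<close> and
    \<open>z\<close> within the range of \<open>upper_linear\<close> simultaneously.\<close>
  define a where "a = 1 / (2 * (1 + tuple_norm h + tuple_norm k + tuple_norm z))"
  have a: "a > 0" "a * tuple_norm h < 1 / 2" "a * tuple_norm k < 1 / 2" "a * tuple_norm z < 1"
    using tuple_norm_nonneg[of h] tuple_norm_nonneg[of k] tuple_norm_nonneg[of z]
    by (auto simp: a_def field_simps)
  define s where "s x = (\<lambda>r. complex_of_real a \<cdot>\<^sub>m x r)" for x :: "'d mat_tuple"
  have st: "s h \<in> tuples n" "s k \<in> tuples n" using hk by (simp_all add: s_def tuples_def)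
  have sn: "tuple_norm (s x) \<le> a * tuple_norm x" if "x \<in> tuples n" for x
    using tuple_norm_smult_le[OF that, of "complex_of_real a"] a by (simp add: s_def)
  have eq: "(\<lambda>r. \<alpha> \<cdot>\<^sub>m s h r + \<beta> \<cdot>\<^sub>m s k r) = s z"
    using carrier_matD[OF hk(1)] carrier_matD[OF hk(2)]
    by (auto simp: s_def z_def algebra_simps intro!: ext eq_matI)
  have up: "upper n (s z) = \<alpha> \<cdot>\<^sub>m upper n (s h) + \<beta> \<cdot>\<^sub>m upper n (s k)"
    using upper_linear[OF n st(1) _ st(2), of \<alpha> \<beta>] sn[OF h] sn[OF k] sn[OF z] a
    by (simp add: eq)
  have d: "deriv0 n x = complex_of_real (1 / a) \<cdot>\<^sub>m upper n (s x)"
    if "x \<in> tuples n" "a * tuple_norm x < 1" for x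
    using deriv0_eq[OF n that(1) a(1) that(2)] by (simp add: s_def)
  have "deriv0 n z = \<alpha> \<cdot>\<^sub>m deriv0 n h + \<beta> \<cdot>\<^sub>m deriv0 n k"
    using a carrier_matD[OF upper_carrier[of n "s h"]] carrier_matD[OF upper_carrier[of n "s k"]]
    by (auto simp: d[OF h] d[OF k] d[OF z] up algebra_simps intro!: eq_matI)
  then show ?thesis by (simp add: z_def)
qed

lemma linear_deriv0: "n \<ge> 1 \<Longrightarrow> linear_on_level n (deriv0 n)"
  unfolding linear_on_level_def
proof (intro conjI ballI allI)
  assume n: "n \<ge> 1"
  fix h k :: "'d mat_tuple" assume h: "h \<in> tuples n" and k: "k \<in> tuples n"
  then have "h r \<in> carrier_mat n n" "k r \<in> carrier_mat n n" for r by (simp_all add: tuples_def)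
  from carrier_matD[OF this(1)] carrier_matD[OF this(2)]
  have eq: "(\<lambda>r. 1 \<cdot>\<^sub>m h r + 1 \<cdot>\<^sub>m k r) = (\<lambda>r. h r + k r)"
    by (auto intro!: ext eq_matI)
  show "deriv0 n (\<lambda>r. h r + k r) = deriv0 n h + deriv0 n k"
    using deriv0_combination[OF n h k, of 1 1] unfolding eq
    by (auto intro!: eq_matI simp: carrier_matD[OF deriv0_carrier])
next
  assume n: "n \<ge> 1"
  fix c and h :: "'d mat_tuple" assume h: "h \<in> tuples n"
  then have "h r \<in> carrier_mat n n" for r by (simp add: tuples_def)
  then have eq: "(\<lambda>r. c \<cdot>\<^sub>m h r + 0 \<cdot>\<^sub>m h r) = (\<lambda>r. c \<cdot>\<^sub>m h r)"
    by (auto intro!: ext eq_matI)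
  show "deriv0 n (\<lambda>r. c \<cdot>\<^sub>m h r) = c \<cdot>\<^sub>m deriv0 n h"
    using deriv0_combination[OF n h h, of c 0] unfolding eq
    by (auto intro!: eq_matI simp: carrier_matD[OF deriv0_carrier])
qed simp

text \<open>Let \<open>F\<close> be the value at the dilation by \<open>C\<close>. Its first block
  column vanishes and the top block of the second is \<open>upper n (a h) = a * deriv0 n h\<close>.
  Applying the top block row to \<open>(a\<^sup>2, a, 1)\<close> gives
  \<open>a\<^sup>2 * f h\<close>, so the top right block is \<open>a\<^sup>2\<close> times the
  remainder, and \<open>F\<close> has norm at most 1.\<close>

lemma remainder_bound:
  assumes n: "n \<ge> 1" and h: "h \<in> tuples n" and a: "a > 0" "(a + 1) * tuple_norm h < 1"
  shows "op_norm (f h - deriv0 n h) \<le> 1 / a\<^sup>2"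
proof -
  define C where "C = mat 3 3 (\<lambda>(c, d). if c = 0 \<and> d = 1 \<or> c = 1 \<and> d = 2 then complex_of_real a
     else if c = 2 \<and> d = 2 then 1 else 0)"
  have C: "C \<in> carrier_mat 3 3" by (simp add: C_def)
  have "op_norm C \<le> a + 1"
  proof (rule op_norm_leI[OF C])
    fix v :: "nat \<Rightarrow> complex"
    have "(\<Sum>i<3. (cmod (\<Sum>j<3. C $$ (i, j) * v j))\<^sup>2) = a\<^sup>2 * (cmod (v 1))\<^sup>2 + (a\<^sup>2 + 1) * (cmod (v 2))\<^sup>2"
      by (simp add: C_def small_index_simps norm_mult power_mult_distrib algebra_simps)
    also have "\<dots> \<le> (a + 1)\<^sup>2 * (cmod (v 1))\<^sup>2 + (a + 1)\<^sup>2 * (cmod (v 2))\<^sup>2"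
      using a by (intro add_mono mult_right_mono) (auto simp: power2_eq_square algebra_simps)
    also have "\<dots> \<le> (a + 1)\<^sup>2 * (\<Sum>j<3. (cmod (v j))\<^sup>2)"
      by (subst distrib_left[symmetric], intro mult_left_mono) (auto simp: small_index_simps)
    finally show "(\<Sum>i<3. (cmod (\<Sum>j<3. C $$ (i, j) * v j))\<^sup>2) \<le> (a + 1)\<^sup>2 * (\<Sum>j<3. (cmod (v j))\<^sup>2)" .
  qed (use a in simp)
  then have CO: "tuple_kron h C \<in> \<Omega>"
    using kron_in_domain[OF n h _ C] a by (simp add: mult.commute)
  define F where "F = f (tuple_kron h C)"
  have Fc: "F \<in> carrier_mat (n * 3) (n * 3)"
    unfolding F_def using n CO tuple_kron_in_tuples[OF h C] by (intro nc_function_carrier[OF nc]) auto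
  have "tuple_norm h \<le> (a + 1) * tuple_norm h" "a * tuple_norm h \<le> (a + 1) * tuple_norm h"
    using a tuple_norm_nonneg[of h] by (auto intro!: mult_right_mono simp: algebra_simps)
  then have h1: "tuple_norm h < 1" and ah: "a * tuple_norm h < 1" using a by auto
  have hO: "h \<in> \<Omega>" using polydisc[OF n h h1] .
  have hr: "h r \<in> carrier_mat n n" for r using h by (simp add: tuples_def)
  define N where "N = complex_of_real a \<cdot>\<^sub>m nilp2"
  have N: "N \<in> carrier_mat 2 2" by (simp add: N_def)
  define g where "g = (\<lambda>r. complex_of_real a \<cdot>\<^sub>m h r)"
  have g: "g \<in> tuples n" "tuple_norm g < 1"
    using hr tuple_norm_smult_le[OF h, of "complex_of_real a"] a ah by (auto simp: g_def tuples_def)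
  have gN: "tuple_kron g nilp2 = tuple_kron h N"
  proof
    fix r
    show "tuple_kron g nilp2 r = tuple_kron h N r"
      unfolding tuple_kron_def g_def N_def
      by (rule eq_block_matI[of _ n 2 n 2])
        (use hr[of r] in \<open>auto simp: index_kron[of _ n n _ 2 2] carrier_matD[OF nilp2_carrier]\<close>)
  qed
  have NO: "tuple_kron h N \<in> \<Omega>" using nilp2_in_domain[OF n g] by (simp add: gN)
  \<comment> \<open>\<open>v\<close> and \<open>e\<close> are eigenvectors of \<open>C\<close> for
    the eigenvalues 1 and 0; the columns of \<open>q\<close> span the invariant subspace on which
    \<open>C\<close> acts as \<open>N\<close>.\<close>
  define v where "v = mat 3 1 (\<lambda>(c, d). if c = 0 then complex_of_real (a * a)
     else if c = 1 then complex_of_real a else 1)"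
  define e where "e = mat 3 1 (\<lambda>(c, d). if c = 0 then 1 else 0 :: complex)"
  define q where "q = mat 3 2 (\<lambda>(c, d). if c = d then 1 else 0 :: complex)"
  have car: "v \<in> carrier_mat 3 1" "e \<in> carrier_mat 3 1" "q \<in> carrier_mat 3 2"
    by (simp_all add: v_def e_def q_def)
  have rel: "v * 1\<^sub>m 1 = C * v" "e * 0\<^sub>m 1 1 = C * e" "q * N = C * q"
    by (rule eq_matI; auto simp: v_def e_def q_def C_def N_def nilp2_def scalar_prod_def small_index_simps)+
  have x1: "tuple_kron h (1\<^sub>m 1) = h" using tuple_kron_one h by blast
  have x0: "tuple_kron h (0\<^sub>m 1 1) = zero_tuple n" using tuple_kron_zero[OF h, of 1] by simp
  have "op_norm (mat n n (\<lambda>(i, j). F $$ (i * 3, j * 3 + 2))) \<le> op_norm F"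
    by (rule op_norm_submatrix_le[OF Fc]) (auto simp: inj_on_def)
  also have "\<dots> \<le> 1" using bound[OF CO] by (simp add: F_def)
  also have "mat n n (\<lambda>(i, j). F $$ (i * 3, j * 3 + 2)) =
      complex_of_real (a\<^sup>2) \<cdot>\<^sub>m (f h - deriv0 n h)"
  proof (rule eq_matI)
    fix i j assume "i < dim_row (complex_of_real (a\<^sup>2) \<cdot>\<^sub>m (f h - deriv0 n h))"
      "j < dim_col (complex_of_real (a\<^sup>2) \<cdot>\<^sub>m (f h - deriv0 n h))"
    then have ij: "i < n" "j < n" by (auto simp: carrier_matD[OF deriv0_carrier])
    have F0: "F $$ (i * 3, j * 3) = 0"
      using nc_function_kron_intertwine[OF nc h zero_carrier_mat _ C CO car(2) rel(2) ij(1) _ ij(2), of 0 0]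
        ij n zero[OF n] zero_in_domain[OF n]
      by (simp add: x0[simplified] F_def[symmetric] lessThan_Suc numeral_3_eq_3 e_def)
    have F1: "F $$ (i * 3, j * 3 + 1) = upper n g $$ (i, j)"
      using nc_function_kron_intertwine[OF nc h N NO C CO car(3) rel(3) ij(1) _ ij(2), of 0 1] ij
      by (simp add: upper_def gN F_def[symmetric] lessThan_Suc numeral_3_eq_3 numeral_2_eq_2 q_def)
    have F2: "a * a * f h $$ (i, j) =
        F $$ (i * 3, j * 3) * (a * a) + F $$ (i * 3, j * 3 + 1) * a + F $$ (i * 3, j * 3 + 2)"
      using nc_function_kron_intertwine[OF nc h one_carrier_mat _ C CO car(1) rel(1) ij(1) _ ij(2), of 0 0]
        ij hO
      by (simp add: x1[simplified] F_def[symmetric] lessThan_Suc numeral_3_eq_3 v_def)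
    have "deriv0 n h $$ (i, j) = upper n g $$ (i, j) / a"
      using deriv0_eq[OF n h a(1) ah] ij carrier_matD[OF upper_carrier[of n g]]
      by (simp add: g_def)
    then show "mat n n (\<lambda>(i, j). F $$ (i * 3, j * 3 + 2)) $$ (i, j) =
        (complex_of_real (a\<^sup>2) \<cdot>\<^sub>m (f h - deriv0 n h)) $$ (i, j)"
      using F0 F1 F2 ij a carrier_matD[OF deriv0_carrier[of n h]]
      by (simp add: power2_eq_square algebra_simps)
  qed (auto simp: carrier_matD[OF deriv0_carrier])
  also have "op_norm \<dots> = a\<^sup>2 * op_norm (f h - deriv0 n h)"
    using op_norm_smult[of "f h - deriv0 n h" n n "complex_of_real (a\<^sup>2)"]
    by (simp add: minus_carrier_mat norm_power)
  finally show ?thesis using a by (simp add: field_simps)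
qed

section \<open>Frechet differentiability and contractivity at the origin\<close>

lemma f_carrier: "n \<ge> 1 \<Longrightarrow> h \<in> tuples n \<Longrightarrow> tuple_norm h < 1 \<Longrightarrow> f h \<in> carrier_mat n n"
  using nc_function_carrier[OF nc] polydisc by blast

lemma zero_tuple_add: "h \<in> tuples n \<Longrightarrow> (\<lambda>r. zero_tuple n r + h r) = h"
  by (auto simp: zero_tuple_def tuples_def)

lemma f_diff_zero:
  assumes "n \<ge> 1" "h \<in> tuples n" "tuple_norm h < 1"
  shows "f (\<lambda>r. zero_tuple n r + h r) - f (zero_tuple n) = f h"
  using f_carrier[OF assms] assms by (auto simp: zero_tuple_add zero intro!: eq_matI)

lemma has_frechet_derivative_deriv0:
  assumes n: "n \<ge> 1"
  shows "has_frechet_derivative_at n (\<Omega> \<inter> tuples n) f (zero_tuple n) (deriv0 n)"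
  unfolding has_frechet_derivative_at_def
proof (intro conjI allI impI linear_deriv0[OF n])
  fix \<epsilon> :: real assume \<epsilon>: "\<epsilon> > 0"
  show "\<exists>\<eta>>0. \<forall>h\<in>tuples n. tuple_norm h < \<eta> \<longrightarrow> (\<lambda>r. zero_tuple n r + h r) \<in> \<Omega> \<inter> tuples n \<and>
    op_norm (f (\<lambda>r. zero_tuple n r + h r) - f (zero_tuple n) - deriv0 n h) \<le> \<epsilon> * tuple_norm h"
  \<comment> \<open>With \<open>a = 1 / (2 * tuple_norm h)\<close> the remainder is at most
    \<open>4 * (tuple_norm h)\<^sup>2\<close>. The bound \<open>1 / 2\<close> ensures
    \<open>(a + 1) * tuple_norm h < 1\<close>, and \<open>\<epsilon> / 4\<close> turns the square
    into \<open>\<epsilon> * tuple_norm h\<close>.\<close>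
  proof (intro exI[of _ "min (1 / 2) (\<epsilon> / 4)"] conjI ballI impI)
    show "0 < min (1 / 2) (\<epsilon> / 4)" using \<epsilon> by simp
    fix h :: "'d mat_tuple" assume h: "h \<in> tuples n" and hn: "tuple_norm h < min (1 / 2) (\<epsilon> / 4)"
    show "(\<lambda>r. zero_tuple n r + h r) \<in> \<Omega> \<inter> tuples n"
      using polydisc[OF n h] h hn by (simp_all add: zero_tuple_add)
    have "op_norm (f h - deriv0 n h) \<le> \<epsilon> * tuple_norm h"
    proof (cases "tuple_norm h = 0")
      case True
      \<comment> \<open>Here every \<open>a > 0\<close> is admissible in
        \<open>remainder_bound\<close>; the one chosen would bound a positive remainder by half of
        itself.\<close>
      have "op_norm (f h - deriv0 n h) \<le> 0"
      proof (rule ccontr)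
        assume "\<not> op_norm (f h - deriv0 n h) \<le> 0"
        then have p: "op_norm (f h - deriv0 n h) > 0" by simp
        then show False
          using remainder_bound[OF n h, of "sqrt (2 / op_norm (f h - deriv0 n h))"] True by simp
      qed
      then show ?thesis using True by simp
    next
      case False
      then have T: "tuple_norm h > 0" using tuple_norm_nonneg[of h] by simp
      have "op_norm (f h - deriv0 n h) \<le> 1 / (1 / (2 * tuple_norm h))\<^sup>2"
        using T hn by (intro remainder_bound[OF n h]) (auto simp: field_simps)
      also have "\<dots> = 4 * tuple_norm h * tuple_norm h" by (simp add: power2_eq_square)
      also have "\<dots> \<le> \<epsilon> * tuple_norm h" using T hn by (intro mult_right_mono) auto
      finally show ?thesis .
    qed
    then show "op_norm (f (\<lambda>r. zero_tuple n r + h r) - f (zero_tuple n) - deriv0 n h) \<le> \<epsilon> * tuple_norm h"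
      using f_diff_zero[OF n h] hn by simp
  qed
qed

text \<open>For small \<open>t > 0\<close> the norm of \<open>L (t h)\<close> is at most that of
  \<open>f (t h)\<close> plus \<open>\<epsilon> t T\<close>, hence at most
  \<open>(1 + \<epsilon>) t T\<close> by \<open>schwarz\<close>. Homogeneity of \<open>L\<close>
  cancels \<open>t\<close>, and \<open>\<epsilon>\<close> is arbitrary.\<close>

lemma frechet_derivative_contractive:
  assumes n: "n \<ge> 1" and L: "has_frechet_derivative_at n D f (zero_tuple n) L"
  shows "contractive_on_level n L"
  unfolding contractive_on_level_def
proof (rule ballI, rule field_le_epsilon)
  fix h :: "'d mat_tuple" and \<gamma> :: real
  assume h: "h \<in> tuples n" and \<gamma>: "\<gamma> > 0"
  define T where "T = tuple_norm h"
  have T: "T \<ge> 0" by (simp add: T_def tuple_norm_nonneg)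
  \<comment> \<open>Dividing by \<open>1 + T\<close> instead of \<open>T\<close>, here and in
    \<open>t\<close>, also covers directions of norm 0.\<close>
  define \<epsilon> where "\<epsilon> = \<gamma> / (1 + T)"
  have \<epsilon>: "\<epsilon> > 0" "\<epsilon> * T \<le> \<gamma>" using T \<gamma> by (auto simp: \<epsilon>_def field_simps)
  obtain \<eta> where \<eta>: "\<eta> > 0" and est: "\<And>h. h \<in> tuples n \<Longrightarrow> tuple_norm h < \<eta> \<Longrightarrow>
      op_norm (f (\<lambda>r. zero_tuple n r + h r) - f (zero_tuple n) - L h) \<le> \<epsilon> * tuple_norm h"
    using L \<epsilon>(1) unfolding has_frechet_derivative_at_def by blast
  define t where "t = min 1 \<eta> / (1 + T)"
  have t: "t > 0" "t * T < 1" "t * T < \<eta>"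
  proof -
    show t0: "t > 0" using T \<eta> by (simp add: t_def)
    have "t * T < t * (1 + T)" using t0 by simp
    also have "\<dots> = min 1 \<eta>" using T by (simp add: t_def)
    finally show "t * T < 1" "t * T < \<eta>" by auto
  qed
  define g where "g = (\<lambda>r. complex_of_real t \<cdot>\<^sub>m h r)"
  have gt: "g \<in> tuples n" using h by (simp add: g_def tuples_def)
  have gn: "tuple_norm g \<le> t * T"
    using tuple_norm_smult_le[OF h, of "complex_of_real t"] t by (simp add: g_def T_def)
  have g1: "tuple_norm g < 1" "tuple_norm g < \<eta>" using gn t by auto
  have lin: "L h \<in> carrier_mat n n" "L g \<in> carrier_mat n n" "L g = complex_of_real t \<cdot>\<^sub>m L h"
    using L h gt by (auto simp: has_frechet_derivative_at_def linear_on_level_def g_def)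
  have fg: "f g \<in> carrier_mat n n" using f_carrier[OF n gt g1(1)] .
  have rem: "op_norm (f g - L g) \<le> \<epsilon> * (t * T)"
    using est[OF gt g1(2), unfolded f_diff_zero[OF n gt g1(1)]] mult_left_mono[OF gn, of \<epsilon>] \<epsilon>(1)
    by linarith
  have R: "f g - L g \<in> carrier_mat n n" using lin(2) by (rule minus_carrier_mat)
  have "L g = f g + (- 1) \<cdot>\<^sub>m (f g - L g)"
    using fg lin(2) by (auto intro!: eq_matI)
  then have "op_norm (L g) \<le> op_norm (f g) + op_norm ((- 1) \<cdot>\<^sub>m (f g - L g))"
    using op_norm_triangle[OF fg, of "(- 1) \<cdot>\<^sub>m (f g - L g)"] R by simp
  also have "\<dots> \<le> t * T + \<epsilon> * (t * T)"
    using schwarz[OF n gt g1(1)] gn rem op_norm_smult[OF R, of "- 1"] by simp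
  finally have "t * op_norm (L h) \<le> t * (T + \<epsilon> * T)"
    using op_norm_smult[OF lin(1), of "complex_of_real t"] lin(3) t by (simp add: algebra_simps)
  then have "op_norm (L h) \<le> T + \<epsilon> * T" using t by simp
  then show "op_norm (L h) \<le> tuple_norm h + \<gamma>" using \<epsilon> by (simp add: T_def)
qed

end

theorem proposition3p1:
  fixes \<delta> :: "'d::finite free_poly mat"
    and f :: "'d mat_tuple \<Rightarrow> complex mat"
    and s r :: nat
  assumes "\<delta> \<in> carrier_mat s r"
    and "\<And>n. n \<ge> 1 \<Longrightarrow> eval_poly_mat n \<delta> (zero_tuple n) = 0\<^sub>m (s * n) (r * n)"
    and "f \<in> RSA \<delta>"
  shows "(\<forall>n\<ge>1. \<forall>x \<in> B_level \<delta> n. op_norm (f x) \<le> op_norm (eval_poly_mat n \<delta> x)) \<and>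
    (nc_polydisc \<subseteq> B_set \<delta> \<longrightarrow>
      (\<forall>n\<ge>1.
        (\<exists>L. has_frechet_derivative_at n (B_level \<delta> n) f (zero_tuple n) L) \<and>
        (\<forall>L. has_frechet_derivative_at n (B_level \<delta> n) f (zero_tuple n) L \<longrightarrow>
          contractive_on_level n L)))"
proof (intro conjI allI ballI impI)
  fix n x assume "n \<ge> (1::nat)" "x \<in> B_level \<delta> n"
  then show "op_norm (f x) \<le> op_norm (eval_poly_mat n \<delta> x)" by (intro RSA_schwarz[OF assms(1) _ assms(3)] assms(2))
next
  assume sub: "nc_polydisc \<subseteq> B_set \<delta>"
  interpret nc_polydisc_map "B_set \<delta>" f
    using assms(3) sub by unfold_locales (auto simp: RSA_def nc_polydisc_def)
  fix n :: nat assume n: "n \<ge> 1"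
  \<comment> \<open>The derivative was obtained on the part of the domain at level \<open>n\<close>,
    which has to be recognised as \<open>B_level \<delta> n\<close>.\<close>
  have "B_set \<delta> \<inter> tuples n = B_level \<delta> n"
    using B_set_level B_level_subset[OF n] by blast
  then show "\<exists>L. has_frechet_derivative_at n (B_level \<delta> n) f (zero_tuple n) L"
    using has_frechet_derivative_deriv0[OF n] by auto
  fix L assume "has_frechet_derivative_at n (B_level \<delta> n) f (zero_tuple n) L"
  then show "contractive_on_level n L" by (rule frechet_derivative_contractive[OF n])
qed

end
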